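(* Let $X$ be a compact subset of a Banach space and let $\varphi:X\to\mathcal{K}(X)$ be a lower semicontinuous multivalued map with convex (nonempty compact) values. Suppose that $h_\mu(\varphi)\geq h_\mu(f)$ for every single-valued continuous selection $f\subset\varphi$ of $\varphi$ and every $f$-invariant Borel probability measure $\mu$. Then \[ \sup_{\mu\in\mathcal{M}_1(\varphi)} h_\mu(\varphi) \geq h_{\mathrm{CMM}}^{\mathrm{sep}}(\varphi)\geq h_{\mathrm{CMM}}^{\mathrm{span}}(\varphi) \] and \[ \sup_{\mu\in\mathcal{M}_1(\varphi)} h_\mu(\varphi) \geq h_+(\varphi), \] where $h_\mu(\varphi)$ is the metric entropy and $h_+(\varphi)$, $h_{\mathrm{CMM}}^{\mathrm{sep}}(\varphi)$, $h_{\mathrm{CMM}}^{\mathrm{span}}(\varphi)$ are the topological entropies of $\varphi$ defined in the context.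
   Context: Multivalued maps. A multivalued map $\varphi:X\multimap Y$ assigns to each $x\in X$ a nonempty subset $\varphi(x)\subset Y$; the notation $\varphi:X\to\mathcal{K}(Y)$ means that all values are nonempty and compact. For $B\subset Y$ the large preimage is $\varphi^{-1}_+(B):=\{x\in X:\varphi(x)\cap B\neq\emptyset\}$. The map $\varphi$ is lower semicontinuous (l.s.c.) if $\varphi^{-1}_+(B)$ is open for every open $B\subset Y$. For $\varphi:X\multimap X$, iterates are $\varphi^0(x)=\{x\}$, $\varphi^{k+1}(x)=\bigcup_{y\in\varphi^k(x)}\varphi(y)$, and $\varphi_+^{-k}(B)=\{x\in X:\varphi^k(x)\cap B\ne\emptyset\}$. A continuous selection $f\subset\varphi$ is a continuous $f:X\to X$ with $f(x)\in\varphi(x)$ for every $x\in X$. Invariant measures. A Borel probability measure $\mu$ on $X$ is $\varphi$-invariant if $\mu(\varphi^{-1}_+(A))\ge\mu(A)$ for every Borel set $A\subset X$. $\mathcal{M}_1(\varphi)$ is the set of all $\varphi$-invariant measures. Metric entropy $h_\mu(\varphi)$. A measurable partition of $X$ is a countable family of pairwise disjoint measurable sets whose union has full measure; its entropy is $H_\mu(\mathcal{P})=-\sum_{P\in\mathcal{P}}\mu(P)\log\mu(P)$ with $0\log 0=0$. For a totally ordered finite partition $\mathcal{P}=\{P_1,\dots,P_m\}$ put $\tilde{\mathcal{P}}_0=\mathcal{P}$ and, for $k\ge1$, let $\tilde{\mathcal{P}}_k$ be the family with elements $\tilde P_{1,k}=\varphi^{-k}_+(P_1)$ and $\tilde P_{j,k}=\varphi^{-k}_+(P_j)\setminus\bigcup_{i<j}\varphi^{-k}_+(P_i)$,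 $j=2,\dots,m$. Let $\mathcal{P}'_n=\bigvee_{k=0}^{n-1}\tilde{\mathcal{P}}_k$ be the family of all nonempty sets $Q_0\cap\dots\cap Q_{n-1}$ with $Q_k\in\tilde{\mathcal{P}}_k$. Set $h_\mu(\varphi,\mathcal{P})=\limsup_{n\to\infty}\frac1n H_\mu(\mathcal{P}'_n)$ and $h_\mu(\varphi)=\sup_{\mathcal{P}}h_\mu(\varphi,\mathcal{P})$, the supremum being over all finite totally ordered partitions of $X$. For a single-valued map $f$ (viewed as $x\mapsto\{f(x)\}$) this is the usual Kolmogorov–Sinai entropy $h_\mu(f)$. Topological entropy $h_+(\varphi)$ (for l.s.c. $\varphi:X\multimap X$, $X$ compact metric). For an open cover $\mathcal{A}$ of $X$ let $\mathcal{A}^n_{\varphi_+}=\bigvee_{j=0}^{n-1}\varphi_+^{-j}(\mathcal{A})$ be the open cover consisting of all nonempty sets $\bigcap_{j=0}^{n-1}\varphi_+^{-j}(A_j)$ with $A_j\in\mathcal{A}$, and let $\mathrm{N}(\mathcal{A}^n_{\varphi_+})$ be the minimal cardinality of a subcover of it. Set $h_+(\varphi,\mathcal{A})=\lim_{n\to\infty}\frac1n\log\mathrm{N}(\mathcal{A}^n_{\varphi_+})$ (the limit exists) and $h_+(\varphi)=\sup\{h_+(\varphi,\mathcal{A}):\mathcal{A}\text{ an open cover of }X\}$. Topological entropies $h_{\mathrm{CMM}}$. Let $d$ be the metric of $X$. For $x\in X$ let $\mathrm{Orb}_n(\varphi,x)$ be the set of $(x_0,\dots,x_{n-1})\in X^n$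 with $x_0=x$ and $x_{i+1}\in\varphi(x_i)$ for $0\le i\le n-2$. Put \[ d_n^{\mathrm{CMM}}(x,y)=\inf_{\bar x\in\mathrm{Orb}_n(\varphi,x),\ \bar y\in\mathrm{Orb}_n(\varphi,y)}\ \max_{0\le i\le n-1}d(\bar x_i,\bar y_i). \] For $\varepsilon>0$, $S\subset X$ is $(\varepsilon,n)_{\mathrm{CMM}}$-separated if $d_n^{\mathrm{CMM}}(x,y)>\varepsilon$ for all distinct $x,y\in S$; $R\subset X$ is $(\varepsilon,n)_{\mathrm{CMM}}$-spanning if for every $y\in X$ there is $x\in R$ with $d_n^{\mathrm{CMM}}(x,y)\le\varepsilon$. Let $s_{\mathrm{CMM}}(\varphi,\varepsilon,n)$ be the largest cardinality of an $(\varepsilon,n)_{\mathrm{CMM}}$-separated set and $r_{\mathrm{CMM}}(\varphi,\varepsilon,n)$ the smallest cardinality of an $(\varepsilon,n)_{\mathrm{CMM}}$-spanning set. Then $h^{\mathrm{sep}}_{\mathrm{CMM}}(\varphi)=\sup_{\varepsilon>0}\limsup_{n\to\infty}\frac1n\log s_{\mathrm{CMM}}(\varphi,\varepsilon,n)$ and $h^{\mathrm{span}}_{\mathrm{CMM}}(\varphi)=\sup_{\varepsilon>0}\limsup_{n\to\infty}\frac1n\log r_{\mathrm{CMM}}(\varphi,\varepsilon,n)$. *)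

theory Defs
  imports "HOL-Probability.Probability"
begin

text \<open>
  A multivalued map is a function into sets; only its values at points of its domain matter.
\<close>

definition multimap_on :: "'a set \<Rightarrow> 'b set \<Rightarrow> ('a \<Rightarrow> 'b set) \<Rightarrow> bool" where
  "multimap_on X Y \<phi> \<longleftrightarrow> (\<forall>x\<in>X. \<phi> x \<noteq> {} \<and> \<phi> x \<subseteq> Y)"

definition large_preimage :: "'a set \<Rightarrow> ('a \<Rightarrow> 'b set) \<Rightarrow> 'b set \<Rightarrow> 'a set" where
  "large_preimage X \<phi> B = {x \<in> X. \<phi> x \<inter> B \<noteq> {}}"

definition lsc_on :: "'a::topological_space set \<Rightarrow> 'b::topological_space set \<Rightarrow>
    ('a \<Rightarrow> 'b set) \<Rightarrow> bool" where
  "lsc_on X Y \<phi> \<longleftrightarrow>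
    (\<forall>B. openin (top_of_set Y) B \<longrightarrow> openin (top_of_set X) (large_preimage X \<phi> B))"

primrec mv_iterate :: "('a \<Rightarrow> 'a set) \<Rightarrow> nat \<Rightarrow> 'a \<Rightarrow> 'a set" where
  "mv_iterate \<phi> 0 x = {x}"
| "mv_iterate \<phi> (Suc k) x = (\<Union>y\<in>mv_iterate \<phi> k x. \<phi> y)"

definition continuous_selection ::
    "'a::topological_space set \<Rightarrow> ('a \<Rightarrow> 'a set) \<Rightarrow> ('a \<Rightarrow> 'a) \<Rightarrow> bool" where
  "continuous_selection X \<phi> f \<longleftrightarrow>
    continuous_on X f \<and> f ` X \<subseteq> X \<and> (\<forall>x\<in>X. f x \<in> \<phi> x)"

text \<open>
  The large preimage of a Borel set under a lower semicontinuous map with compact values is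
  analytic, hence universally measurable, but in general not Borel. Its measure is therefore the
  one given by the completion of the Borel measure. On sets measurable for the completion this
  is the same as the outer measure, and on Borel sets it is the measure itself; \<^const>\<open>emeasure\<close>
  would return the default value 0 on sets that are not Borel.

  For a map \<open>\<lambda>x. {f x}\<close> with f continuous, the inequality for a set and for its complement give
  equality, so this is invariance of the measure under f in the usual sense.
\<close>

definition borel_prob_measures :: "'a::topological_space set \<Rightarrow> 'a measure set" where
  "borel_prob_measures X = {\<mu>. sets \<mu> = sets (restrict_space borel X) \<and> prob_space \<mu>}"

definition invariant_measures ::
    "'a::topological_space set \<Rightarrow> ('a \<Rightarrow> 'a set) \<Rightarrow> 'a measure set" where
  "invariant_measures X \<phi> = {\<mu> \<in> borel_prob_measures X.
     \<forall>A\<in>sets \<mu>. outer_measure_of \<mu> (large_preimage X \<phi> A) \<ge> emeasure \<mu> A}"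

text \<open>
  A totally ordered finite partition is the list of its members in increasing order.
\<close>

definition ordered_partition :: "'a measure \<Rightarrow> 'a set list \<Rightarrow> bool" where
  "ordered_partition \<mu> Ps \<longleftrightarrow> set Ps \<subseteq> sets \<mu>
     \<and> disjoint_family_on (\<lambda>j. Ps ! j) {..<length Ps}
     \<and> emeasure \<mu> (\<Union>(set Ps)) = emeasure \<mu> (space \<mu>)"

definition partition_entropy :: "'a measure \<Rightarrow> 'a set set \<Rightarrow> real" where
  "partition_entropy \<mu> \<P> =
     - (\<Sum>P\<in>\<P>. enn2real (outer_measure_of \<mu> P) * ln (enn2real (outer_measure_of \<mu> P)))"

definition tilde_part ::
    "'a set \<Rightarrow> ('a \<Rightarrow> 'a set) \<Rightarrow> 'a set list \<Rightarrow> nat \<Rightarrow> nat \<Rightarrow> 'a set" where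
  "tilde_part X \<phi> Ps k j =
     (if k = 0 then Ps ! j
      else large_preimage X (mv_iterate \<phi> k) (Ps ! j)
           - (\<Union>i<j. large_preimage X (mv_iterate \<phi> k) (Ps ! i)))"

definition tilde_partition ::
    "'a set \<Rightarrow> ('a \<Rightarrow> 'a set) \<Rightarrow> 'a set list \<Rightarrow> nat \<Rightarrow> 'a set set" where
  "tilde_partition X \<phi> Ps k = tilde_part X \<phi> Ps k ` {..<length Ps}"

definition joint_family :: "'a set \<Rightarrow> (nat \<Rightarrow> 'a set set) \<Rightarrow> nat \<Rightarrow> 'a set set" where
  "joint_family X \<F> n =
     {X \<inter> (\<Inter>k<n. Q k) | Q. (\<forall>k<n. Q k \<in> \<F> k) \<and> X \<inter> (\<Inter>k<n. Q k) \<noteq> {}}"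

definition metric_entropy_wrt ::
    "'a set \<Rightarrow> ('a \<Rightarrow> 'a set) \<Rightarrow> 'a measure \<Rightarrow> 'a set list \<Rightarrow> ereal" where
  "metric_entropy_wrt X \<phi> \<mu> Ps = limsup (\<lambda>n.
     ereal (partition_entropy \<mu> (joint_family X (tilde_partition X \<phi> Ps) n) / real n))"

definition metric_entropy ::
    "'a set \<Rightarrow> ('a \<Rightarrow> 'a set) \<Rightarrow> 'a measure \<Rightarrow> ereal" where
  "metric_entropy X \<phi> \<mu> = (SUP Ps \<in> {Ps. ordered_partition \<mu> Ps}. metric_entropy_wrt X \<phi> \<mu> Ps)"

definition ecard :: "'a set \<Rightarrow> enat" where
  "ecard A = (if finite A then enat (card A) else \<infinity>)"

text \<open>The value at 0 is relevant only for the empty space.\<close>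

definition elog :: "enat \<Rightarrow> ereal" where
  "elog N = (case N of enat m \<Rightarrow> if m = 0 then - \<infinity> else ereal (ln (real m)) | \<infinity> \<Rightarrow> \<infinity>)"

definition open_cover :: "'a::topological_space set \<Rightarrow> 'a set set \<Rightarrow> bool" where
  "open_cover X \<A> \<longleftrightarrow> (\<forall>A\<in>\<A>. openin (top_of_set X) A) \<and> \<Union>\<A> = X"

definition iterated_cover ::
    "'a set \<Rightarrow> ('a \<Rightarrow> 'a set) \<Rightarrow> 'a set set \<Rightarrow> nat \<Rightarrow> 'a set set" where
  "iterated_cover X \<phi> \<A> n = joint_family X (\<lambda>j. large_preimage X (mv_iterate \<phi> j) ` \<A>) n"

definition min_subcover_card :: "'a set \<Rightarrow> 'a set set \<Rightarrow> enat" where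
  "min_subcover_card X \<C> = (INF \<B> \<in> {\<B>. \<B> \<subseteq> \<C> \<and> \<Union>\<B> = X}. ecard \<B>)"

definition cover_entropy_wrt :: "'a set \<Rightarrow> ('a \<Rightarrow> 'a set) \<Rightarrow> 'a set set \<Rightarrow> ereal" where
  "cover_entropy_wrt X \<phi> \<A> =
     lim (\<lambda>n. elog (min_subcover_card X (iterated_cover X \<phi> \<A> n)) / ereal (real n))"

definition cover_entropy :: "'a::topological_space set \<Rightarrow> ('a \<Rightarrow> 'a set) \<Rightarrow> ereal" where
  "cover_entropy X \<phi> = (SUP \<A> \<in> {\<A>. open_cover X \<A>}. cover_entropy_wrt X \<phi> \<A>)"

text \<open>For n = 0 the sets below are irrelevant: the entropies depend only on large n.\<close>

definition orbits :: "'a set \<Rightarrow> ('a \<Rightarrow> 'a set) \<Rightarrow> nat \<Rightarrow> 'a \<Rightarrow> 'a list set" where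
  "orbits X \<phi> n x = {xs. length xs = n \<and> set xs \<subseteq> X \<and> xs ! 0 = x
     \<and> (\<forall>i. Suc i < n \<longrightarrow> xs ! Suc i \<in> \<phi> (xs ! i))}"

definition dist_CMM ::
    "'a::metric_space set \<Rightarrow> ('a \<Rightarrow> 'a set) \<Rightarrow> nat \<Rightarrow> 'a \<Rightarrow> 'a \<Rightarrow> real" where
  "dist_CMM X \<phi> n x y =
     (INF (xs, ys) \<in> orbits X \<phi> n x \<times> orbits X \<phi> n y. MAX i \<in> {..<n}. dist (xs ! i) (ys ! i))"

definition separated_CMM ::
    "'a::metric_space set \<Rightarrow> ('a \<Rightarrow> 'a set) \<Rightarrow> real \<Rightarrow> nat \<Rightarrow> 'a set \<Rightarrow> bool" where
  "separated_CMM X \<phi> \<epsilon> n S \<longleftrightarrow>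
     S \<subseteq> X \<and> (\<forall>x\<in>S. \<forall>y\<in>S. x \<noteq> y \<longrightarrow> dist_CMM X \<phi> n x y > \<epsilon>)"

definition spanning_CMM ::
    "'a::metric_space set \<Rightarrow> ('a \<Rightarrow> 'a set) \<Rightarrow> real \<Rightarrow> nat \<Rightarrow> 'a set \<Rightarrow> bool" where
  "spanning_CMM X \<phi> \<epsilon> n R \<longleftrightarrow>
     R \<subseteq> X \<and> (\<forall>y\<in>X. \<exists>x\<in>R. dist_CMM X \<phi> n x y \<le> \<epsilon>)"

definition s_CMM :: "'a::metric_space set \<Rightarrow> ('a \<Rightarrow> 'a set) \<Rightarrow> real \<Rightarrow> nat \<Rightarrow> enat" where
  "s_CMM X \<phi> \<epsilon> n = (SUP S \<in> {S. separated_CMM X \<phi> \<epsilon> n S}. ecard S)"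

definition r_CMM :: "'a::metric_space set \<Rightarrow> ('a \<Rightarrow> 'a set) \<Rightarrow> real \<Rightarrow> nat \<Rightarrow> enat" where
  "r_CMM X \<phi> \<epsilon> n = (INF R \<in> {R. spanning_CMM X \<phi> \<epsilon> n R}. ecard R)"

definition h_sep_CMM :: "'a::metric_space set \<Rightarrow> ('a \<Rightarrow> 'a set) \<Rightarrow> ereal" where
  "h_sep_CMM X \<phi> =
     (SUP \<epsilon> \<in> {0<..}. limsup (\<lambda>n. elog (s_CMM X \<phi> \<epsilon> n) / ereal (real n)))"

definition h_span_CMM :: "'a::metric_space set \<Rightarrow> ('a \<Rightarrow> 'a set) \<Rightarrow> ereal" where
  "h_span_CMM X \<phi> =
     (SUP \<epsilon> \<in> {0<..}. limsup (\<lambda>n. elog (r_CMM X \<phi> \<epsilon> n) / ereal (real n)))"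

end

theory Submission
  imports Defs
begin

text \<open>
  By Michael's theorem \<open>\<phi>\<close> has a continuous selection \<open>f\<close>. Orbits of \<open>f\<close> are orbits of \<open>\<phi>\<close> and
  preimages under \<open>f\<close> lie in the large preimages under \<open>\<phi>\<close>, so every topological entropy of \<open>\<phi>\<close> is at
  most the growth rate of separated sets of \<open>f\<close>. Misiurewicz's construction gives \<open>f\<close>-invariant
  measures whose entropy is at least this growth rate; such measures are \<open>\<phi>\<close>-invariant, and the
  hypothesis carries the bound from \<open>f\<close> to \<open>\<phi>\<close>.

  The invariant measure is found without integrals: the empirical averages of the separated sets are
  finitely additive on all subsets of \<open>X\<close>, Tychonoff's theorem yields a limit that is invariant
  and finitely additive, and inner approximation by compact sets turns that limit into a Borel measure
  with the same value on every set whose boundary is null.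
\<close>

subsection \<open>Continuous selections\<close>

text \<open>The finitely additive limit and the Borel measure can disagree: when point masses move
  towards a boundary point of a set, the limit may leave the mass on the set although the measure
  does not. Agreement is available only for sets with null boundary. This dictates the order of
  choices: the fine partition is picked after the measure, with classes whose boundaries are null
  for it. Invariance makes all preimages of these classes harmless as well, so the frequencies of
  words of each fixed length converge to the measures of cells, and an inequality about finite
  separated sets can pass to the limit one block length at a time.

  The metric entropy of \<open>\<phi>\<close> itself is never computed; it enters only through the
  hypothesis. Large preimages of disjoint sets can overlap and need not be Borel, whereas a
  continuous selection pulls a Borel partition back to a Borel partition.\<close>

lemma approximate_selection:
  fixes X :: "'a::metric_space set" and \<phi> :: "'a \<Rightarrow> 'b::real_normed_vector set"
  assumes "compact X" and ne: "\<And>x. x \<in> X \<Longrightarrow> \<phi> x \<noteq> {}"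
    and conv: "\<And>x. x \<in> X \<Longrightarrow> convex (\<phi> x)"
    and lsc: "\<And>B. open B \<Longrightarrow> openin (top_of_set X) (large_preimage X \<phi> B)"
    and "e > 0"
  obtains f where "continuous_on X f" and "\<And>x. x \<in> X \<Longrightarrow> \<exists>y\<in>\<phi> x. dist (f x) y < e"
proof -
  obtain y where y: "\<And>x. x \<in> X \<Longrightarrow> y x \<in> \<phi> x"
    using ne that[of "\<lambda>x. SOME y. y \<in> \<phi> x"] by (simp add: some_in_eq)
  have "\<exists>T. open T \<and> large_preimage X \<phi> (ball (y x) e) = X \<inter> T" for x
    using lsc[of "ball (y x) e"] by (auto simp: openin_open)
  then obtain T where T: "\<And>x. open (T x)" "\<And>x. large_preimage X \<phi> (ball (y x) e) = X \<inter> T x"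
    by metis
  have "x \<in> T x" if "x \<in> X" for x
  proof -
    have "x \<in> large_preimage X \<phi> (ball (y x) e)"
      using that y \<open>e > 0\<close> by (force simp: large_preimage_def)
    then show ?thesis using T by auto
  qed
  then have "X \<subseteq> (\<Union>x\<in>X. T x)" by auto
  then obtain C where C: "C \<subseteq> X" "finite C" "X \<subseteq> (\<Union>c\<in>C. T c)"
    using compactE_image[OF \<open>compact X\<close>, of X T] T by metis
  \<comment> \<open>The partition of unity is indexed by the open sets of the cover. Different
    centres may have the same set, so \<open>c\<close> fixes one centre for each set.\<close>
  define \<C> where "\<C> = T ` C"
  have "\<exists>c. c \<in> C \<and> T c = U" if "U \<in> \<C>" for U using that by (auto simp: \<C>_def)
  then obtain c where c: "\<And>U. U \<in> \<C> \<Longrightarrow> c U \<in> C \<and> T (c U) = U" by metis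
  have fin: "finite \<C>" using C by (simp add: \<C>_def)
  obtain F :: "['a set, 'a] \<Rightarrow> real"
    where F: "\<And>U. U \<in> \<C> \<Longrightarrow> continuous_on X (F U) \<and> (\<forall>x \<in> X. 0 \<le> F U x)"
      and F0: "\<And>x U. \<lbrakk>U \<in> \<C>; x \<in> X; x \<notin> U\<rbrakk> \<Longrightarrow> F U x = 0"
      and F1: "\<And>x. x \<in> X \<Longrightarrow> supp_sum (\<lambda>W. F W x) \<C> = 1"
  proof (rule subordinate_partition_of_unity[of X \<C>])
    show "X \<subseteq> \<Union>\<C>" using C by (auto simp: \<C>_def)
    show "open U" if "U \<in> \<C>" for U using that T by (auto simp: \<C>_def)
    show "\<exists>V. open V \<and> x \<in> V \<and> finite {U \<in> \<C>. U \<inter> V \<noteq> {}}" for x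
      using fin by (intro exI[of _ UNIV]) auto
  qed blast
  have F1': "(\<Sum>U\<in>\<C>. F U x) = 1" if "x \<in> X" for x
  proof -
    have "supp_sum (\<lambda>W. F W x) \<C> = (\<Sum>U\<in>\<C>. F U x)"
      unfolding supp_sum_def support_on_def using fin by (intro sum.mono_neutral_left) auto
    then show ?thesis using F1 that by simp
  qed
  define f where "f x = (\<Sum>U\<in>\<C>. F U x *\<^sub>R y (c U))" for x
  show thesis
  proof
    show "continuous_on X f" unfolding f_def
      using F by (intro continuous_intros) auto
    fix x assume x: "x \<in> X"
    \<comment> \<open>\<open>N\<close> is the open \<open>e\<close>-neighbourhood of
      \<open>\<phi> x\<close>, convex as a sum of convex sets. A centre value with nonzero weight at
      \<open>x\<close> lies in it, because \<open>x\<close> then belongs to the corresponding set of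
      the cover.\<close>
    define N where "N = (\<Union>u\<in>\<phi> x. \<Union>v\<in>ball 0 e. {u + v})"
    have cN: "convex N" unfolding N_def
      using conv[OF x] by (intro convex_sums) auto
    have inN: "y (c U) \<in> N" if "U \<in> \<C>" "F U x \<noteq> 0" for U
    proof -
      have "x \<in> U" using F0 that x by auto
      then have "x \<in> large_preimage X \<phi> (ball (y (c U)) e)" using T c that x by auto
      then obtain u where "u \<in> \<phi> x" "dist (y (c U)) u < e" by (auto simp: large_preimage_def)
      then have "y (c U) = u + (y (c U) - u)" "y (c U) - u \<in> ball 0 e"
        by (auto simp: dist_norm norm_minus_commute)
      then show ?thesis unfolding N_def using \<open>u \<in> \<phi> x\<close> by blast
    qed
    have "f x = (\<Sum>U\<in>{U\<in>\<C>. F U x \<noteq> 0}. F U x *\<^sub>R y (c U))"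
      unfolding f_def using fin by (intro sum.mono_neutral_right) auto
    also have "\<dots> \<in> N"
    proof (rule convex_sum[OF _ cN])
      show "(\<Sum>U\<in>{U\<in>\<C>. F U x \<noteq> 0}. F U x) = 1"
        using F1'[OF x] fin by (subst sum.mono_neutral_left[of \<C>]) auto
    qed (use fin inN F x in auto)
    finally show "\<exists>y\<in>\<phi> x. dist (f x) y < e"
      by (force simp: N_def dist_norm)
  qed
qed

text \<open>Each approximation is improved near the previous one: the next is chosen for
  \<open>\<phi> x\<close> cut down to an open ball around the current value. Cutting with an open
  ball whose centre moves continuously keeps lower semicontinuity but can destroy closedness, so the
  approximation step works with convex values and closedness enters only for the limit.\<close>

theorem michael_selection:
  fixes X :: "'a::metric_space set" and \<phi> :: "'a \<Rightarrow> 'b::banach set"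
  assumes "compact X" and ne: "\<And>x. x \<in> X \<Longrightarrow> \<phi> x \<noteq> {}"
    and conv: "\<And>x. x \<in> X \<Longrightarrow> convex (\<phi> x)"
    and clo: "\<And>x. x \<in> X \<Longrightarrow> closed (\<phi> x)"
    and lsc: "\<And>B. open B \<Longrightarrow> openin (top_of_set X) (large_preimage X \<phi> B)"
  obtains f where "continuous_on X f" and "\<And>x. x \<in> X \<Longrightarrow> f x \<in> \<phi> x"
proof -
  define P where "P n f \<longleftrightarrow> continuous_on X f \<and> (\<forall>x\<in>X. \<exists>y\<in>\<phi> x. dist (f x) y < (1/2)^n)"
    for n and f :: "'a \<Rightarrow> 'b"
  define Q where "Q n f g \<longleftrightarrow> (\<forall>x\<in>X. dist (g x) (f x) \<le> 2 * (1/2)^n)"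
    for n :: nat and f g :: "'a \<Rightarrow> 'b"
  have "\<exists>f. \<forall>n. P n (f n) \<and> Q n (f n) (f (Suc n))"
  proof (rule dependent_nat_choice)
    show "\<exists>f. P 0 f"
    proof -
      obtain f where "continuous_on X f" "\<And>x. x \<in> X \<Longrightarrow> \<exists>y\<in>\<phi> x. dist (f x) y < 1"
        by (rule approximate_selection[OF assms(1-3) lsc, of 1]) auto
      then show ?thesis by (auto simp: P_def)
    qed
    fix f n assume P: "P n f"
    define r :: real where "r = (1/2)^n"
    define \<psi> where "\<psi> x = \<phi> x \<inter> ball (f x) r" for x
    have fc: "continuous_on X f" using P by (simp add: P_def)
    obtain g where g: "continuous_on X g" "\<And>x. x \<in> X \<Longrightarrow> \<exists>y\<in>\<psi> x. dist (g x) y < r/2"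
    proof (rule approximate_selection[OF assms(1), of \<psi> "r/2"])
      show "\<psi> x \<noteq> {}" "convex (\<psi> x)" if "x \<in> X" for x
        using P that conv by (fastforce simp: P_def \<psi>_def r_def intro!: convex_Int)+
      show "openin (top_of_set X) (large_preimage X \<psi> B)" if "open B" for B
      proof (subst openin_subopen, safe)
        fix x assume "x \<in> large_preimage X \<psi> B"
        then obtain y where x: "x \<in> X" and y: "y \<in> \<phi> x" "dist (f x) y < r" "y \<in> B"
          by (auto simp: large_preimage_def \<psi>_def)
        \<comment> \<open>Half the slack of \<open>y\<close> in the ball: moving the centre and
          moving \<open>y\<close> may each cost less than \<open>\<delta>\<close>.\<close>
        define \<delta> where "\<delta> = (r - dist (f x) y)/2"
        have \<delta>: "\<delta> > 0" using y by (simp add: \<delta>_def)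
        define W where "W = large_preimage X \<phi> (B \<inter> ball y \<delta>) \<inter> (X \<inter> f -` ball (f x) \<delta>)"
        have "openin (top_of_set X) W" unfolding W_def
          using lsc[of "B \<inter> ball y \<delta>"] \<open>open B\<close> continuous_openin_preimage_gen[OF fc, of "ball (f x) \<delta>"]
          by (intro openin_Int[of _ "large_preimage X \<phi> _"]) auto
        moreover have "x \<in> W" using x y \<delta> by (force simp: W_def large_preimage_def)
        moreover have "W \<subseteq> large_preimage X \<psi> B"
        proof
          fix x' assume "x' \<in> W"
          then obtain z where z: "x' \<in> X" "z \<in> \<phi> x'" "z \<in> B" "dist y z < \<delta>" "dist (f x) (f x') < \<delta>"
            by (auto simp: W_def large_preimage_def)
          have "dist (f x') z \<le> dist (f x') (f x) + dist (f x) y + dist y z" by metric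
          also have "\<dots> < r" using z \<delta> by (simp add: \<delta>_def dist_commute)
          finally show "x' \<in> large_preimage X \<psi> B" using z by (auto simp: large_preimage_def \<psi>_def)
        qed
        ultimately show "\<exists>W. openin (top_of_set X) W \<and> x \<in> W \<and> W \<subseteq> large_preimage X \<psi> B" by blast
      qed
    qed (auto simp: r_def)
    have "P (Suc n) g" using g by (force simp: P_def \<psi>_def r_def)
    moreover have "Q n f g" unfolding Q_def
    proof
      fix x assume "x \<in> X"
      then obtain y where "dist (f x) y < r" "dist (g x) y < r/2" using g(2)[OF \<open>x \<in> X\<close>] by (auto simp: \<psi>_def)
      then have "dist (g x) (f x) \<le> 2 * r"
        using dist_triangle2[of "g x" "f x" y] zero_le_dist[of "g x" y] by linarith
      then show "dist (g x) (f x) \<le> 2 * (1/2)^n" by (simp add: r_def)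
    qed
    ultimately show "\<exists>g. P (Suc n) g \<and> Q n f g" by blast
  qed
  then obtain f where f: "\<And>n. P n (f n)" "\<And>n. Q n (f n) (f (Suc n))" by blast
  \<comment> \<open>The M-test speaks of series, so the sequence is written as a telescoping sum;
    \<open>f 0\<close> is added back at the end.\<close>
  have "uniformly_convergent_on X (\<lambda>n x. \<Sum>i<n. f (Suc i) x - f i x)"
  proof (rule Weierstrass_m_test')
    show "norm (f (Suc n) x - f n x) \<le> 2 * (1/2)^n" if "x \<in> X" for n x
      using f(2) that by (simp add: Q_def dist_norm)
    show "summable (\<lambda>n. 2 * (1/2)^n :: real)" by (intro summable_mult summable_geometric) auto
  qed
  moreover have "(\<Sum>i<n. f (Suc i) x - f i x) = f n x - f 0 x" for n x
    by (rule sum_lessThan_telescope[of "\<lambda>i. f i x"])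
  ultimately obtain g where g: "uniform_limit X (\<lambda>n x. f n x - f 0 x) g sequentially"
    by (auto simp: uniformly_convergent_on_def)
  have "continuous_on X g"
    using g by (rule uniform_limit_theorem[rotated])
      (use f(1) in \<open>auto simp: P_def intro!: always_eventually continuous_intros\<close>)
  show thesis
  proof
    show "continuous_on X (\<lambda>x. g x + f 0 x)"
      using f(1)[of 0] \<open>continuous_on X g\<close> by (auto simp: P_def intro!: continuous_intros)
    fix x assume x: "x \<in> X"
    have "\<exists>y. y \<in> \<phi> x \<and> dist (f n x) y < (1/2)^n" for n
      using f(1) x by (auto simp: P_def)
    then obtain y where y: "\<And>n. y n \<in> \<phi> x" "\<And>n. dist (f n x) (y n) < (1/2)^n" by metis
    have "(\<lambda>n. f n x - f 0 x) \<longlonglongrightarrow> g x" using g x by (rule tendsto_uniform_limitI)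
    then have "(\<lambda>n. (f n x - f 0 x) + f 0 x) \<longlonglongrightarrow> g x + f 0 x" by (intro tendsto_intros)
    then have fl: "(\<lambda>n. f n x) \<longlonglongrightarrow> g x + f 0 x" by simp
    have "(\<lambda>n. y n - f n x) \<longlonglongrightarrow> 0"
    proof (rule Lim_null_comparison[OF always_eventually])
      show "\<forall>n. norm (y n - f n x) \<le> (1/2)^n"
        using y(2) by (auto simp: dist_norm norm_minus_commute intro: less_imp_le)
      show "(\<lambda>n. (1/2)^n :: real) \<longlonglongrightarrow> 0" by (intro LIMSEQ_power_zero) auto
    qed
    with fl have "y \<longlonglongrightarrow> g x + f 0 x" by (rule Lim_transform)
    then show "g x + f 0 x \<in> \<phi> x"
      using closed_sequentially[OF clo[OF x]] y by blast
  qed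
qed

subsection \<open>Measures from finitely additive limits\<close>

text \<open>One filter serves every \<open>A\<close> at once. Limits along it respect finite sums
  and inequalities, which is how additivity and invariance will pass to \<open>c\<close>. The
  functions into the unit interval form a compact space by Tychonoff, and its topology is pointwise
  convergence.\<close>

lemma cluster_point_of_unit_functions:
  fixes m :: "nat \<Rightarrow> 'b \<Rightarrow> real"
  assumes m: "\<And>n A. m n A \<in> {0..1}"
  obtains c G where "G \<noteq> bot" "G \<le> sequentially" "\<And>A. ((\<lambda>n. m n A) \<longlongrightarrow> c A) G"
proof -
  define K where "K = (PiE UNIV (\<lambda>_. {0..1}) :: ('b \<Rightarrow> real) set)"
  have "compactin (product_topology (\<lambda>_. euclidean) UNIV) K"
    unfolding K_def by (auto simp: compactin_PiE)
  then have "compact K" by (simp add: euclidean_product_topology)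
  moreover have "eventually (\<lambda>f. f \<in> K) (filtermap m sequentially)"
    using m by (auto simp: K_def eventually_filtermap PiE_iff intro!: always_eventually)
  moreover have "filtermap m sequentially \<noteq> bot" by (simp add: filtermap_bot_iff)
  ultimately obtain c where c: "inf (nhds c) (filtermap m sequentially) \<noteq> bot"
    unfolding compact_filter by blast
  \<comment> \<open>a nontrivial filter takes the place of a subsequence, which need not exist for uncountably many \<open>A\<close>\<close>
  define G where "G = inf (filtercomap m (nhds c)) sequentially"
  show thesis
  proof
    show "G \<le> sequentially" by (simp add: G_def)
    show "G \<noteq> bot"
    proof
      assume "G = bot"
      then have "eventually (\<lambda>_. False) G" by simp
      then obtain P Q where P: "eventually P (filtercomap m (nhds c))" and Q: "eventually Q sequentially"
        and PQ: "\<And>x. P x \<Longrightarrow> Q x \<Longrightarrow> False"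
        unfolding G_def eventually_inf by blast
      from P obtain R where R: "eventually R (nhds c)" "\<And>x. R (m x) \<Longrightarrow> P x"
        by (auto simp: eventually_filtercomap)
      have "eventually (\<lambda>f. \<not> R f) (filtermap m sequentially)"
        unfolding eventually_filtermap using Q by eventually_elim (use R PQ in blast)
      then have "eventually (\<lambda>_. False) (inf (nhds c) (filtermap m sequentially))"
        unfolding eventually_inf using R(1) by blast
      then show False using c by (simp add: trivial_limit_def)
    qed
    fix A
    have mc: "filterlim m (nhds c) G"
      unfolding filterlim_iff_le_filtercomap by (simp add: G_def)
    show "((\<lambda>n. m n A) \<longlongrightarrow> c A) G"
    proof (rule topological_tendstoI)
      fix S assume S: "open S" "c A \<in> S"
      have "open {f :: 'b \<Rightarrow> real. f A \<in> S}"
        using product_topology_basis'[of "{A}" "\<lambda>_. S" id] S by simp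
      then have "eventually (\<lambda>f. f A \<in> S) (nhds c)"
        using S unfolding eventually_nhds by blast
      then show "eventually (\<lambda>n. m n A \<in> S) G"
        using mc unfolding filterlim_iff by blast
    qed
  qed
qed

text \<open>Inner content and induced outer measure, as in the construction of a regular measure
  from a content. The supremum over compact sets discards mass that \<open>c\<close> places in an
  open set but that has escaped to its boundary.\<close>

definition content_open :: "'a::metric_space set \<Rightarrow> ('a set \<Rightarrow> real) \<Rightarrow> 'a set \<Rightarrow> ennreal" where
  "content_open X c U = (SUP K \<in> {K. compact K \<and> K \<subseteq> X \<inter> U}. ennreal (c K))"

definition content_outer :: "'a::metric_space set \<Rightarrow> ('a set \<Rightarrow> real) \<Rightarrow> 'a set \<Rightarrow> ennreal" where
  "content_outer X c A = (INF U \<in> {U. open U \<and> A \<subseteq> U}. content_open X c U)"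

locale finitely_additive_probability =
  fixes X :: "'a::metric_space set" and c :: "'a set \<Rightarrow> real"
  assumes compact: "compact X"
    and nonneg: "c A \<ge> 0"
    and additive: "A \<inter> B = {} \<Longrightarrow> c (A \<union> B) = c A + c B"
    and total: "c X = 1"
begin

lemma empty: "c {} = 0"
  using additive[of "{}" "{}"] by simp

lemma mono: "A \<subseteq> B \<Longrightarrow> c A \<le> c B"
  using additive[of A "B - A"] nonneg[of "B - A"] by (simp add: Un_absorb1)

lemma le_Un: "c (A \<union> B) \<le> c A + c B"
  using additive[of A "B - A"] mono[of "B - A" B] by simp

lemma diff: "A \<subseteq> X \<Longrightarrow> c (X - A) = 1 - c A"
  using additive[of A "X - A"] total by (simp add: Un_absorb1)

lemma content_open_mono: "U \<subseteq> V \<Longrightarrow> content_open X c U \<le> content_open X c V"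
  unfolding content_open_def by (intro SUP_subset_mono) auto

lemma content_open_upper: "compact K \<Longrightarrow> K \<subseteq> X \<inter> U \<Longrightarrow> ennreal (c K) \<le> content_open X c U"
  unfolding content_open_def by (intro SUP_upper) auto

lemma content_open_le: "content_open X c U \<le> ennreal (c (X \<inter> U))"
  unfolding content_open_def by (intro SUP_least ennreal_leI mono) auto

lemma content_outer_open: "open U \<Longrightarrow> content_outer X c U = content_open X c U"
  unfolding content_outer_def
  by (intro antisym INF_lower INF_greatest content_open_mono) auto

lemma content_outer_mono: "A \<subseteq> B \<Longrightarrow> content_outer X c A \<le> content_outer X c B"
  unfolding content_outer_def by (intro INF_superset_mono) auto

text \<open>Normality separates the two parts of \<open>K\<close> that only one of the open sets
  covers. The splitting lets subadditivity of \<open>c\<close> on compact sets pass to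
  \<open>content_open\<close>.\<close>

lemma compact_split:
  fixes K :: "'a set"
  assumes "compact K" "open U" "open V" "K \<subseteq> U \<union> V"
  obtains K1 K2 where "compact K1" "compact K2" "K1 \<subseteq> U" "K2 \<subseteq> V" "K = K1 \<union> K2"
proof -
  have "closed (K - U)" "closed (K - V)" "(K - U) \<inter> (K - V) = {}"
    using assms compact_imp_closed[OF assms(1)] by (auto intro!: closed_Diff)
  then obtain S T where "open S" "open T" "K - U \<subseteq> S" "K - V \<subseteq> T" "S \<inter> T = {}"
    using t4_space[of "K - U" "K - V"] by blast
  with assms show thesis by (intro that[of "K - S" "K - T"] compact_diff) auto
qed

lemma content_le_sum_open:
  assumes "\<And>i. open (U i)" "compact K" "K \<subseteq> X" "K \<subseteq> (\<Union>i<(n::nat). U i)"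
  shows "ennreal (c K) \<le> (\<Sum>i<n. content_open X c (U i))"
  using assms(2-)
proof (induction n arbitrary: K)
  case 0
  then show ?case using empty by simp
next
  case (Suc n)
  obtain K1 K2 where K: "compact K1" "compact K2" "K1 \<subseteq> (\<Union>i<n. U i)" "K2 \<subseteq> U n" "K = K1 \<union> K2"
    by (rule compact_split[OF Suc.prems(1), of "\<Union>i<n. U i" "U n"])
      (use assms(1) Suc.prems in \<open>auto simp: lessThan_Suc\<close>)
  have "ennreal (c K) \<le> ennreal (c K1) + ennreal (c K2)"
    using le_Un[of K1 K2] nonneg K(5) by (simp flip: ennreal_plus add: ennreal_leI)
  also have "\<dots> \<le> (\<Sum>i<n. content_open X c (U i)) + content_open X c (U n)"
    using Suc K by (intro add_mono Suc.IH content_open_upper) auto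
  finally show ?case by simp
qed

text \<open>The only source of countable subadditivity: a compact set inside the union already lies
  in finitely many of the open sets, where finite additivity of \<open>c\<close> suffices.\<close>

lemma content_open_UN_le:
  assumes "\<And>i::nat. open (U i)"
  shows "content_open X c (\<Union>i. U i) \<le> (\<Sum>i. content_open X c (U i))"
  unfolding content_open_def[of X c "\<Union>i. U i"]
proof (rule SUP_least)
  fix K assume "K \<in> {K. compact K \<and> K \<subseteq> X \<inter> (\<Union>i. U i)}"
  then have K: "compact K" "K \<subseteq> X" "K \<subseteq> (\<Union>i. U i)" by auto
  obtain I where I: "I \<subseteq> UNIV" "finite I" "K \<subseteq> (\<Union>i\<in>I. U i)"
    by (rule compactE_image[OF K(1) assms K(3)])
  obtain n where "I \<subseteq> {..<n}" using finite_nat_iff_bounded[of I] I(2) by auto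
  then have "K \<subseteq> (\<Union>i<n. U i)" using I by blast
  then have "ennreal (c K) \<le> (\<Sum>i<n. content_open X c (U i))"
    using assms K by (intro content_le_sum_open) auto
  also have "\<dots> \<le> (\<Sum>i. content_open X c (U i))" by (intro sum_le_suminf) auto
  finally show "ennreal (c K) \<le> (\<Sum>i. content_open X c (U i))" .
qed

lemma outer_measure_space_content: "outer_measure_space UNIV (content_outer X c)"
  unfolding outer_measure_space_def
proof (intro conjI)
  show "positive UNIV (content_outer X c)"
    using content_open_le[of "{}"] empty by (simp add: positive_def content_outer_open)
  show "increasing UNIV (content_outer X c)"
    by (simp add: increasing_def content_outer_mono)
  show "countably_subadditive UNIV (content_outer X c)"
    unfolding countably_subadditive_def
  proof safe
    fix A :: "nat \<Rightarrow> 'a set"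
    show "content_outer X c (\<Union>i. A i) \<le> (\<Sum>i. content_outer X c (A i))"
    proof (rule ennreal_le_epsilon)
      fix e :: real assume "0 < e" "(\<Sum>n. content_outer X c (A n)) < top"
      then have *: "\<And>n. content_outer X c (A n) < content_outer X c (A n) + e * (1/2)^Suc n"
        by (auto simp add: less_top dest!: ennreal_suminf_lessD)
      have "\<exists>U. open U \<and> A n \<subseteq> U \<and> content_open X c U \<le> content_outer X c (A n) + e * (1/2)^Suc n" for n
        using *[of n] unfolding content_outer_def[of X c "A n"] INF_less_iff by (auto intro: less_imp_le)
      then obtain U where U: "\<And>n. open (U n)" "\<And>n. A n \<subseteq> U n"
          "\<And>n. content_open X c (U n) \<le> content_outer X c (A n) + e * (1/2)^Suc n"
        by metis
      have "content_outer X c (\<Union>i. A i) \<le> content_outer X c (\<Union>i. U i)"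
        using U by (intro content_outer_mono) auto
      also have "\<dots> = content_open X c (\<Union>i. U i)" using U by (intro content_outer_open) auto
      also have "\<dots> \<le> (\<Sum>i. content_open X c (U i))" using U by (intro content_open_UN_le) auto
      also have "\<dots> \<le> (\<Sum>n. content_outer X c (A n) + e * (1/2) ^ Suc n)"
        using U by (intro suminf_le) auto
      also have "... = (\<Sum>n. content_outer X c (A n)) + (\<Sum>n. ennreal e * ennreal ((1/2) ^ Suc n))"
        using \<open>0 < e\<close> by (subst suminf_add[symmetric])
          (auto simp del: ennreal_suminf_cmult simp add: ennreal_mult[symmetric])
      also have "\<dots> = (\<Sum>n. content_outer X c (A n)) + e"
        unfolding ennreal_suminf_cmult
        by (subst suminf_ennreal_eq[OF zero_le_power power_half_series]) auto
      finally show "content_outer X c (\<Union>i. A i) \<le> (\<Sum>i. content_outer X c (A i)) + e" .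
    qed
  qed
qed

lemma content_outer_subadditive: "content_outer X c (A \<union> B) \<le> content_outer X c A + content_outer X c (B - A)"
proof -
  have "subadditive UNIV (content_outer X c)"
    using outer_measure_space_content
    by (intro ring_of_sets.countably_subadditive_subadditive[of UNIV UNIV] ring_of_setsI)
      (auto simp: outer_measure_space_def)
  then show ?thesis using subadditiveD[of UNIV "content_outer X c" A "B - A"] by simp
qed

text \<open>For an open \<open>E\<close> containing \<open>x\<close>, exhaust
  \<open>G \<inter> E\<close> by compact sets \<open>K\<close>. The open set \<open>E - K\<close>
  still covers the part of \<open>x\<close> outside \<open>G\<close>, and any compact
  \<open>K'\<close> inside it is disjoint from \<open>K\<close>, so \<open>c K + c K'\<close> is the
  value of \<open>c\<close> on one compact subset of \<open>E\<close>.\<close>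

lemma open_in_lambda_system:
  assumes G: "open G"
  shows "G \<in> lambda_system UNIV UNIV (content_outer X c)"
  unfolding lambda_system_def
proof (clarsimp, rule antisym)
  fix x
  have "G \<inter> x \<union> x = x" "x - G \<inter> x = (UNIV - G) \<inter> x" by auto
  then show "content_outer X c x \<le> content_outer X c (G \<inter> x) + content_outer X c ((UNIV - G) \<inter> x)"
    using content_outer_subadditive[of "G \<inter> x" x] by simp
  show "content_outer X c (G \<inter> x) + content_outer X c ((UNIV - G) \<inter> x) \<le> content_outer X c x"
    unfolding content_outer_def[of X c x]
  proof (rule INF_greatest, clarify)
    fix E assume E: "open E" "x \<subseteq> E"
    have ne: "{K. compact K \<and> K \<subseteq> X \<inter> U} \<noteq> {}" for U by (auto intro: exI[of _ "{}"])
    have *: "ennreal (c K) + content_outer X c ((UNIV - G) \<inter> x) \<le> content_open X c E"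
      if K: "compact K" "K \<subseteq> X \<inter> (G \<inter> E)" for K
    proof -
      have "content_outer X c ((UNIV - G) \<inter> x) \<le> content_outer X c (E - K)"
        using K E by (intro content_outer_mono) auto
      also have "\<dots> = content_open X c (E - K)"
        using K E by (intro content_outer_open open_Diff compact_imp_closed)
      finally have "ennreal (c K) + content_outer X c ((UNIV - G) \<inter> x) \<le> ennreal (c K) + content_open X c (E - K)"
        by (rule add_left_mono)
      also have "\<dots> = (SUP K'\<in>{K'. compact K' \<and> K' \<subseteq> X \<inter> (E - K)}. ennreal (c K) + ennreal (c K'))"
        unfolding content_open_def by (rule ennreal_SUP_add_right[OF ne])
      also have "\<dots> \<le> content_open X c E"
      proof (rule SUP_least, clarify)
        fix K' assume K': "compact K'" "K' \<subseteq> X \<inter> (E - K)"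
        have "ennreal (c K) + ennreal (c K') = ennreal (c (K \<union> K'))"
          using K' nonneg by (subst additive) (auto simp: ennreal_plus)
        also have "\<dots> \<le> content_open X c E"
          using K K' by (intro content_open_upper) auto
        finally show "ennreal (c K) + ennreal (c K') \<le> content_open X c E" .
      qed
      finally show ?thesis .
    qed
    have "content_outer X c (G \<inter> x) \<le> content_outer X c (G \<inter> E)"
      using E by (intro content_outer_mono) auto
    also have "\<dots> = content_open X c (G \<inter> E)" using G E by (intro content_outer_open) auto
    finally have "content_outer X c (G \<inter> x) + content_outer X c ((UNIV - G) \<inter> x)
        \<le> content_open X c (G \<inter> E) + content_outer X c ((UNIV - G) \<inter> x)" by (rule add_right_mono)
    also have "\<dots> = (SUP K\<in>{K. compact K \<and> K \<subseteq> X \<inter> (G \<inter> E)}. ennreal (c K) + content_outer X c ((UNIV - G) \<inter> x))"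
      unfolding content_open_def by (rule ennreal_SUP_add_left[OF ne, symmetric])
    also have "\<dots> \<le> content_open X c E" using * by (intro SUP_least) auto
    finally show "content_outer X c (G \<inter> x) + content_outer X c ((UNIV - G) \<inter> x) \<le> content_open X c E" .
  qed
qed

lemma ex_regular_measure:
  obtains M where "M \<in> borel_prob_measures X"
    and "\<And>U. open U \<Longrightarrow> emeasure M (X \<inter> U) = content_open X c U"
proof -
  let ?L = "lambda_system UNIV UNIV (content_outer X c)"
  interpret sigma_algebra "UNIV :: 'a set" UNIV
    using sigma_algebra_Pow[of "UNIV :: 'a set"] by simp
  have L: "measure_space UNIV ?L (content_outer X c)"
    using caratheodory_lemma[OF outer_measure_space_content] .
  then have L': "sigma_algebra UNIV ?L" by (simp add: measure_space_def)
  have "sigma_sets UNIV (Collect open) \<subseteq> ?L"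
    using open_in_lambda_system by (intro sigma_algebra.sigma_sets_subset[OF L']) blast
  then have sub: "sets borel \<subseteq> ?L" by (simp add: borel_def)
  define M0 where "M0 = measure_of UNIV (sets borel) (content_outer X c)"
  have sets0: "sets M0 = sets (borel :: 'a measure)"
    unfolding M0_def using sets.sets_measure_of_eq[of "borel :: 'a measure"] by simp
  have "measure_space UNIV (sets borel) (content_outer X c)"
    by (rule measure_down[OF L _ sub]) (use sets.sigma_algebra_axioms[of "borel :: 'a measure"] in simp)
  then have em0: "emeasure M0 A = content_outer X c A" if "A \<in> sets borel" for A
    using that unfolding M0_def measure_space_def
    by (intro emeasure_measure_of_sigma) auto
  have Xb: "X \<in> sets borel" using compact by (intro borel_compact)
  define M where "M = restrict_space M0 X"
  have em: "emeasure M A = content_outer X c A" if "A \<in> sets borel" "A \<subseteq> X" for A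
    unfolding M_def using that Xb sets0 em0
    by (subst emeasure_restrict_space) (auto simp: sets_eq_imp_space_eq[OF sets0])
  have spM: "space M = X" unfolding M_def space_restrict_space sets_eq_imp_space_eq[OF sets0] by simp
  show thesis
  proof
    show "emeasure M (X \<inter> U) = content_open X c U" if "open U" for U
    proof -
      have *: "X \<inter> U \<union> U = U" "U - X \<inter> U = U - X" by auto
      have "content_open X c U = content_outer X c U" using that by (simp add: content_outer_open)
      also have "\<dots> \<le> content_outer X c (X \<inter> U) + content_outer X c (U - X)"
        using content_outer_subadditive[of "X \<inter> U" U] unfolding * .
      \<comment> \<open>The outer measure lives on the whole space. The complement of
        \<open>X\<close> is open and contains no nonempty compact subset of \<open>X\<close>, hence
        is null.\<close>
      also have "content_outer X c (U - X) \<le> content_open X c (- X)"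
        using compact unfolding content_outer_def
        by (intro INF_lower) (auto simp: compact_imp_closed)
      also have "\<dots> \<le> 0" using content_open_le[of "- X"] empty by simp
      finally have "content_open X c U \<le> content_outer X c (X \<inter> U)" by simp
      moreover have "content_outer X c (X \<inter> U) \<le> content_open X c U"
        using that unfolding content_outer_def by (intro INF_lower) auto
      ultimately show ?thesis using that Xb by (subst em) auto
    qed
    \<comment> \<open>\<open>X\<close> is compact and thus a competitor in its own supremum, so no
      mass is lost.\<close>
    from this[of UNIV] have "emeasure M X = content_open X c UNIV" by simp
    also have "\<dots> = 1" using content_open_upper[of X UNIV] content_open_le[of UNIV] total compact
      by (intro antisym) auto
    finally have "prob_space M" by (intro prob_spaceI) (simp add: spM)
    then show "M \<in> borel_prob_measures X"
      unfolding borel_prob_measures_def M_def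
      using sets_restrict_space_cong[OF sets0] by simp
  qed
qed

end

section \<open>Borel probability measures on a set and their continuity sets\<close>

lemma borel_prob_measuresD:
  assumes "M \<in> borel_prob_measures X"
  shows "sets M = sets (restrict_space borel X)" "prob_space M" "space M = X"
proof -
  show *: "sets M = sets (restrict_space borel X)" "prob_space M"
    using assms by (auto simp: borel_prob_measures_def)
  show "space M = X" using sets_eq_imp_space_eq[OF *(1)] by (simp add: space_restrict_space)
qed

lemma sets_borel_prob_measure:
  assumes "M \<in> borel_prob_measures X" "B \<in> sets borel"
  shows "X \<inter> B \<in> sets M"
  using assms(2) by (auto simp: borel_prob_measuresD(1)[OF assms(1)] sets_restrict_space)

lemma continuous_measurable_borel_prob_measure:
  assumes "M \<in> borel_prob_measures X" "continuous_on X f"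
  shows "f \<in> borel_measurable M"
  using borel_measurable_continuous_on_restrict[OF assms(2)]
    measurable_cong_sets[OF borel_prob_measuresD(1)[OF assms(1)] refl] by blast

lemma preimage_in_sets_borel_prob_measure:
  assumes M: "M \<in> borel_prob_measures X" and f: "continuous_on X f" "f ` X \<subseteq> X" and B: "B \<in> sets M"
  shows "X \<inter> f -` B \<in> sets M"
proof -
  obtain B' where B': "B' \<in> sets borel" "B = X \<inter> B'"
    using B by (auto simp: borel_prob_measuresD(1)[OF M] sets_restrict_space)
  have "f -` B' \<inter> space M \<in> sets M"
    using continuous_measurable_borel_prob_measure[OF M f(1)] B'(1) by (rule measurable_sets)
  moreover have "f -` B' \<inter> space M = X \<inter> f -` B"
    using f(2) B' by (auto simp: borel_prob_measuresD(3)[OF M])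
  ultimately show ?thesis by simp
qed

text \<open>
  The boundary is taken relative to \<open>X\<close>. Witnesses \<open>U\<close> and \<open>F\<close> replace interior and closure
  because they pull back along maps that are continuous only on \<open>X\<close>.
\<close>

definition continuity_set :: "'a::topological_space set \<Rightarrow> 'a measure \<Rightarrow> 'a set \<Rightarrow> bool" where
  "continuity_set X M A \<longleftrightarrow> A \<in> sets M \<and>
     (\<exists>U F. open U \<and> closed F \<and> X \<inter> U \<subseteq> A \<and> A \<subseteq> F \<and> emeasure M (X \<inter> F - U) = 0)"

lemma continuity_set_Int:
  assumes M: "M \<in> borel_prob_measures X" and "continuity_set X M A" "continuity_set X M B"
  shows "continuity_set X M (A \<inter> B)"
proof -
  obtain U F where A: "open U" "closed F" "X \<inter> U \<subseteq> A" "A \<subseteq> F" "emeasure M (X \<inter> F - U) = 0" "A \<in> sets M"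
    using assms(2) by (auto simp: continuity_set_def)
  obtain V G where B: "open V" "closed G" "X \<inter> V \<subseteq> B" "B \<subseteq> G" "emeasure M (X \<inter> G - V) = 0" "B \<in> sets M"
    using assms(3) by (auto simp: continuity_set_def)
  have s: "X \<inter> F - U \<in> sets M" "X \<inter> G - V \<in> sets M"
    using sets_borel_prob_measure[OF M, of "F - U"] sets_borel_prob_measure[OF M, of "G - V"] A B
    by (auto simp: Int_Diff)
  have "emeasure M (X \<inter> (F \<inter> G) - (U \<inter> V)) \<le> emeasure M ((X \<inter> F - U) \<union> (X \<inter> G - V))"
    using s by (intro emeasure_mono) auto
  also have "\<dots> \<le> 0" using emeasure_subadditive[OF s] A B by simp
  finally have "emeasure M (X \<inter> (F \<inter> G) - (U \<inter> V)) = 0" by simp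
  moreover have "X \<inter> (U \<inter> V) \<subseteq> A \<inter> B" "A \<inter> B \<subseteq> F \<inter> G" using A(3,4) B(3,4) by auto
  moreover have "open (U \<inter> V)" "closed (F \<inter> G)" "A \<inter> B \<in> sets M" using A B by auto
  ultimately show ?thesis unfolding continuity_set_def by blast
qed

lemma continuity_set_Diff:
  assumes M: "M \<in> borel_prob_measures X" and "continuity_set X M A"
  shows "continuity_set X M (X - A)"
proof -
  obtain U F where A: "open U" "closed F" "X \<inter> U \<subseteq> A" "A \<subseteq> F" "emeasure M (X \<inter> F - U) = 0" "A \<in> sets M"
    using assms(2) by (auto simp: continuity_set_def)
  have "X \<inter> - U - - F = X \<inter> F - U" by auto
  moreover have "X - A \<in> sets M" using A(6) borel_prob_measuresD(3)[OF M] by (metis sets.compl_sets)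
  ultimately show ?thesis unfolding continuity_set_def using A
    by (intro conjI exI[of _ "- F"] exI[of _ "- U"]) auto
qed

text \<open>The gap between the pulled-back witnesses is the preimage of the old gap, and invariance
  keeps it null. Continuity alone would not.\<close>

lemma continuity_set_vimage:
  assumes M: "M \<in> borel_prob_measures X" and f: "continuous_on X f" "f ` X \<subseteq> X"
    and inv: "\<And>B. B \<in> sets M \<Longrightarrow> emeasure M (X \<inter> f -` B) = emeasure M B"
    and "continuity_set X M A"
  shows "continuity_set X M (X \<inter> f -` A)"
proof -
  obtain U F where A: "open U" "closed F" "X \<inter> U \<subseteq> A" "A \<subseteq> F" "emeasure M (X \<inter> F - U) = 0" "A \<in> sets M"
    using assms(5) by (auto simp: continuity_set_def)
  obtain U' where U': "open U'" "X \<inter> f -` U = X \<inter> U'"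
    using continuous_openin_preimage_gen[OF f(1) A(1)] by (auto simp: openin_open)
  obtain F' where F': "closed F'" "X \<inter> f -` F = X \<inter> F'"
    using continuous_closedin_preimage[OF f(1) A(2)] by (auto simp: closedin_closed)
  have s: "X \<inter> F - U \<in> sets M"
    using sets_borel_prob_measure[OF M, of "F - U"] A by (auto simp: Int_Diff)
  have "X \<inter> F' - U' = (X \<inter> f -` F) - (X \<inter> f -` U)" using U'(2) F'(2) by blast
  also have "\<dots> = X \<inter> f -` (X \<inter> F - U)" using f(2) by auto
  finally have "X \<inter> F' - U' = X \<inter> f -` (X \<inter> F - U)" .
  then have z: "emeasure M (X \<inter> F' - U') = 0" using inv[OF s] A(5) by simp
  have "f x \<in> A" if "x \<in> X" "x \<in> U'" for x
  proof -
    have "x \<in> X \<inter> f -` U" using U'(2) that by blast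
    then show ?thesis using A(3) f(2) that by blast
  qed
  moreover have "x \<in> X \<inter> F'" if "x \<in> X" "f x \<in> A" for x
    using F'(2) A(4) that by blast
  ultimately have "X \<inter> U' \<subseteq> X \<inter> f -` A" "X \<inter> f -` A \<subseteq> F'" by auto
  with U' F' z preimage_in_sets_borel_prob_measure[OF M f A(6)] show ?thesis
    unfolding continuity_set_def by blast
qed

text \<open>Spheres of different radii around \<open>x\<close> are disjoint, so at most countably
  many carry mass. In terms of the distribution of \<open>dist x\<close>, these radii are its
  atoms.\<close>

lemma ex_continuity_ball:
  fixes X :: "'a::metric_space set"
  assumes M: "M \<in> borel_prob_measures X" and "e > 0"
  obtains r where "0 < r" "r < e" "continuity_set X M (X \<inter> ball x r)"
proof -
  interpret prob_space M by (rule borel_prob_measuresD[OF M])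
  have d: "dist x \<in> borel_measurable M"
    by (rule continuous_measurable_borel_prob_measure[OF M]) (intro continuous_intros)
  interpret N: prob_space "distr M borel (dist x)" by (rule prob_space_distr[OF d])
  have "uncountable {0<..<e}" using \<open>e > 0\<close> by (simp add: uncountable_open_interval)
  then have "\<not> {0<..<e} \<subseteq> {r. measure (distr M borel (dist x)) {r} \<noteq> 0}"
    using N.countable_support countable_subset by blast
  then obtain r where r: "0 < r" "r < e" "measure (distr M borel (dist x)) {r} = 0" by auto
  have "X \<inter> cball x r - ball x r = dist x -` {r} \<inter> space M"
    using borel_prob_measuresD(3)[OF M] by auto
  then have "emeasure M (X \<inter> cball x r - ball x r) = emeasure (distr M borel (dist x)) {r}"
    using d by (simp add: emeasure_distr)
  also have "\<dots> = 0" using r by (simp add: N.emeasure_eq_measure)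
  finally have "continuity_set X M (X \<inter> ball x r)"
    unfolding continuity_set_def using sets_borel_prob_measure[OF M, of "ball x r"]
    by (intro conjI exI[of _ "ball x r"] exI[of _ "cball x r"]) auto
  with r that show thesis by blast
qed

context finitely_additive_probability
begin

lemma regular_measure_invariant:
  assumes M: "M \<in> borel_prob_measures X"
    and em: "\<And>U. open U \<Longrightarrow> emeasure M (X \<inter> U) = content_open X c U"
    and f: "continuous_on X f" "f ` X \<subseteq> X"
    and inv: "\<And>A. A \<subseteq> X \<Longrightarrow> c (X \<inter> f -` A) = c A"
    and B: "B \<in> sets M"
  shows "emeasure M (X \<inter> f -` B) = emeasure M B"
proof -
  interpret prob_space M by (rule borel_prob_measuresD[OF M])
  have op: "emeasure M (X \<inter> f -` U) = emeasure M (X \<inter> U)" if U: "open U" for U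
  proof -
    obtain V where V: "open V" "X \<inter> f -` U = X \<inter> V"
      using continuous_openin_preimage_gen[OF f(1) U] by (auto simp: openin_open)
    have "content_open X c U \<le> content_open X c V"
      unfolding content_open_def[of X c U]
    proof (rule SUP_least, clarify)
      fix K assume K: "compact K" "K \<subseteq> X \<inter> U"
      have "closedin (top_of_set X) (X \<inter> f -` K)"
        using K by (intro continuous_closedin_preimage[OF f(1)] compact_imp_closed)
      then have "compact (X \<inter> f -` K)" using compact closedin_compact by blast
      moreover have "X \<inter> f -` K \<subseteq> X \<inter> V" using V K by auto
      ultimately have "ennreal (c (X \<inter> f -` K)) \<le> content_open X c V" by (rule content_open_upper)
      then show "ennreal (c K) \<le> content_open X c V" using inv[of K] K by simp
    qed
    moreover have "content_open X c V \<le> content_open X c U"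
      unfolding content_open_def[of X c V]
    proof (rule SUP_least, clarify)
      fix K assume K: "compact K" "K \<subseteq> X \<inter> V"
      have "compact (f ` K)" using K f by (intro compact_continuous_image continuous_on_subset[OF f(1)]) auto
      moreover have fK: "f ` K \<subseteq> X \<inter> U"
      proof
        fix y assume "y \<in> f ` K"
        then obtain x where "x \<in> K" "y = f x" by auto
        moreover from this have "x \<in> X \<inter> f -` U" using V K by blast
        ultimately show "y \<in> X \<inter> U" using f(2) by auto
      qed
      ultimately have "ennreal (c (f ` K)) \<le> content_open X c U" by (rule content_open_upper)
      moreover have "c K \<le> c (X \<inter> f -` (f ` K))" using K by (intro mono) auto
      ultimately show "ennreal (c K) \<le> content_open X c U"
        using inv[of "f ` K"] fK by (metis Int_subset_iff dual_order.trans ennreal_leI)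
    qed
    ultimately show ?thesis using em U V by simp
  qed
  have fm: "f \<in> borel_measurable M" by (rule continuous_measurable_borel_prob_measure[OF M f(1)])
  have im: "(\<lambda>x. x) \<in> borel_measurable M"
    by (rule continuous_measurable_borel_prob_measure[OF M]) auto
  \<comment> \<open>\<open>M\<close> lives on \<open>X\<close> while the generator consists of open
    sets of the whole space; the image under the identity transfers \<open>M\<close> there.\<close>
  have "distr M borel f = distr M borel (\<lambda>x. x)"
  proof (rule measure_eqI_generator_eq)
    show "Int_stable {U :: 'a set. open U}" by (auto simp: Int_stable_def)
    show "{U. open U} \<subseteq> Pow UNIV" by simp
    show "emeasure (distr M borel f) U = emeasure (distr M borel (\<lambda>x. x)) U" if "U \<in> {U. open U}" for U
      using op[of U] that fm im by (simp add: emeasure_distr borel_prob_measuresD(3)[OF M] Int_commute)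
    show "range (\<lambda>_::nat. UNIV) \<subseteq> {U :: 'a set. open U}" by auto
    show "emeasure (distr M borel f) UNIV \<noteq> \<infinity>"
      using fm by (simp add: emeasure_distr emeasure_eq_measure)
  qed (auto simp: borel_def)
  moreover obtain B' where B': "B' \<in> sets borel" "B = X \<inter> B'"
    using B by (auto simp: borel_prob_measuresD(1)[OF M] sets_restrict_space)
  moreover have "X \<inter> f -` B = f -` B' \<inter> space M" using B' f(2) borel_prob_measuresD(3)[OF M] by auto
  ultimately show ?thesis
    using fm im emeasure_distr[OF fm B'(1)] emeasure_distr[OF im B'(1)]
    by (simp add: borel_prob_measuresD(3)[OF M] Int_commute)
qed

text \<open>On open sets the measure is at most \<open>c\<close>, and by complements it is at least
  \<open>c\<close> on closed sets. Both values of \<open>A\<close> are squeezed between those of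
  \<open>X \<inter> U\<close> and \<open>X \<inter> F\<close>, which have equal measure.\<close>

lemma regular_measure_continuity_set:
  assumes M: "M \<in> borel_prob_measures X"
    and em: "\<And>U. open U \<Longrightarrow> emeasure M (X \<inter> U) = content_open X c U"
    and A: "continuity_set X M A"
  shows "measure M A = c A"
proof -
  interpret prob_space M by (rule borel_prob_measuresD[OF M])
  note sp = borel_prob_measuresD(3)[OF M]
  obtain U F where UF: "open U" "closed F" "X \<inter> U \<subseteq> A" "A \<subseteq> F" "emeasure M (X \<inter> F - U) = 0" "A \<in> sets M"
    using A by (auto simp: continuity_set_def)
  have AX: "A \<subseteq> X" using sets.sets_into_space[OF UF(6)] sp by simp
  have s: "X \<inter> F \<in> sets M" "X \<inter> U \<in> sets M" "X \<inter> F - U \<in> sets M"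
    using sets_borel_prob_measure[OF M, of F] sets_borel_prob_measure[OF M, of U]
      sets_borel_prob_measure[OF M, of "F - U"] UF by (auto simp: Int_Diff)
  have le: "measure M (X \<inter> V) \<le> c (X \<inter> V)" if "open V" for V
    using em[OF that] content_open_le[of V] nonneg
    by (metis emeasure_eq_measure ennreal_le_iff)
  have "measure M (X \<inter> F) \<le> measure M (X \<inter> U) + measure M (X \<inter> F - U)"
    using s by (intro order.trans[OF finite_measure_mono measure_Un_le]) auto
  also have "measure M (X \<inter> F - U) = 0" using UF by (simp add: measure_def)
  finally have FU: "measure M (X \<inter> F) \<le> measure M (X \<inter> U)" by simp
  have "X \<inter> - F = X - X \<inter> F" by auto
  then have "measure M (X \<inter> - F) = 1 - measure M (X \<inter> F)" "c (X \<inter> - F) = 1 - c (X \<inter> F)"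
    using prob_compl[OF s(1)] diff[of "X \<inter> F"] sp by auto
  then have "c (X \<inter> F) \<le> measure M (X \<inter> F)" using le[of "- F"] UF by auto
  moreover have "c A \<le> c (X \<inter> F)" using UF AX by (intro mono) auto
  moreover have "measure M (X \<inter> U) \<le> c (X \<inter> U)" using le UF by auto
  moreover have "c (X \<inter> U) \<le> c A" using UF by (intro mono) auto
  moreover have "measure M (X \<inter> U) \<le> measure M A" "measure M A \<le> measure M (X \<inter> F)"
    using UF s AX by (auto intro!: finite_measure_mono)
  ultimately show ?thesis using FU by linarith
qed

end

subsection \<open>Entropy of blocks\<close>

definition words :: "'l set \<Rightarrow> nat \<Rightarrow> 'l list set" where
  "words L q = {u. set u \<subseteq> L \<and> length u = q}"

lemma finite_words: "finite L \<Longrightarrow> finite (words L q)"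
  unfolding words_def by (rule finite_lists_length_eq)

lemma sum_words_append:
  fixes F G :: "'l list \<Rightarrow> real"
  assumes "finite L"
  shows "(\<Sum>u\<in>words L (a + b). F (take a u) * G (drop a u)) = (\<Sum>u\<in>words L a. F u) * (\<Sum>v\<in>words L b. G v)"
proof -
  have "(\<Sum>u\<in>words L (a + b). F (take a u) * G (drop a u))
      = (\<Sum>(u, v)\<in>words L a \<times> words L b. F u * G v)"
    by (rule sum.reindex_bij_witness[where i = "\<lambda>(u, v). u @ v" and j = "\<lambda>u. (take a u, drop a u)"])
      (auto simp: words_def dest: in_set_takeD in_set_dropD)
  then show ?thesis using assms by (simp add: sum_product sum.cartesian_product)
qed

lemma sum_words_uniform:
  assumes "finite L" "L \<noteq> {}"
  shows "(\<Sum>u\<in>words L r. (1 / real (card L)) ^ r) = 1"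
proof -
  have "card L > 0" using assms by (simp add: card_gt_0_iff)
  then show ?thesis using assms card_lists_length_eq[of L r] by (simp add: words_def power_divide)
qed

text \<open>The density of a product law on words: \<open>m\<close> independent blocks with law
  \<open>\<nu>\<close>, followed by independent uniform letters from an alphabet of size
  \<open>l\<close>.\<close>

primrec block_weight :: "('l list \<Rightarrow> real) \<Rightarrow> nat \<Rightarrow> nat \<Rightarrow> nat \<Rightarrow> 'l list \<Rightarrow> real" where
  "block_weight \<nu> q l 0 u = (1 / real l) ^ length u"
| "block_weight \<nu> q l (Suc m) u = \<nu> (take q u) * block_weight \<nu> q l m (drop q u)"

lemma sum_block_weight:
  assumes "finite L" "L \<noteq> {}" "(\<Sum>u\<in>words L q. \<nu> u) = 1"
  shows "(\<Sum>u\<in>words L (m * q + r). block_weight \<nu> q (card L) m u) = 1"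
proof (induction m)
  case 0
  have "(\<Sum>u\<in>words L r. (1 / real (card L)) ^ length u) = (\<Sum>u\<in>words L r. (1 / real (card L)) ^ r)"
    by (intro sum.cong) (auto simp: words_def)
  then show ?case using sum_words_uniform[OF assms(1,2)] by simp
next
  case (Suc m)
  then show ?case
    using sum_words_append[OF assms(1), of \<nu> q "block_weight \<nu> q (card L) m" "m * q + r"] assms(3)
    by (simp add: add.assoc)
qed

lemma block_weight_map:
  assumes "j + m * q \<le> n"
  shows "block_weight \<nu> q l m (map s [j..<n])
    = (\<Prod>i<m. \<nu> (map s [j + i * q..<j + i * q + q])) * (1 / real l) ^ (n - j - m * q)"
  using assms
proof (induction m arbitrary: j)
  case 0
  then show ?case by simp
next
  case (Suc m)
  have "take q [j..<n] = [j..<j + q]" "drop q [j..<n] = [j + q..<n]"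
    using Suc.prems by (auto simp: take_upt drop_upt)
  then have "block_weight \<nu> q l (Suc m) (map s [j..<n])
      = \<nu> (map s [j..<j + q]) * block_weight \<nu> q l m (map s [j + q..<n])"
    by (simp add: take_map drop_map)
  also have "\<dots> = \<nu> (map s [j..<j + q]) * ((\<Prod>i<m. \<nu> (map s [j + q + i * q..<j + q + i * q + q]))
      * (1 / real l) ^ (n - (j + q) - m * q))"
    using Suc.prems by (subst Suc.IH) auto
  also have "\<dots> = (\<Prod>i<Suc m. \<nu> (map s [j + i * q..<j + i * q + q])) * (1 / real l) ^ (n - j - Suc m * q)"
    by (simp add: prod.lessThan_Suc_shift algebra_simps del: prod.lessThan_Suc)
  finally show ?case .
qed

text \<open>Gibbs' inequality against the uniform law on \<open>E\<close>: take
  \<open>ln z \<le> z - 1\<close> at \<open>z = card E * t x\<close> and sum. A total weight of at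
  most 1 suffices, so \<open>t\<close> may be part of a larger probability vector.\<close>

lemma gibbs_uniform:
  fixes t :: "'a \<Rightarrow> real"
  assumes "finite E" "E \<noteq> {}" "\<And>x. x \<in> E \<Longrightarrow> t x > 0" "(\<Sum>x\<in>E. t x) \<le> 1"
  shows "real (card E) * ln (real (card E)) \<le> (\<Sum>x\<in>E. - ln (t x))"
proof -
  define N where "N = real (card E)"
  have N: "N > 0" using assms by (simp add: N_def card_gt_0_iff)
  have "(\<Sum>x\<in>E. ln N + ln (t x)) \<le> (\<Sum>x\<in>E. N * t x - 1)"
  proof (rule sum_mono)
    fix x assume "x \<in> E"
    then have "t x > 0" using assms by simp
    then show "ln N + ln (t x) \<le> N * t x - 1"
      using ln_le_minus_one[of "N * t x"] N by (simp add: ln_mult)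
  qed
  also have "\<dots> = N * (\<Sum>x\<in>E. t x) - N" by (simp add: sum_subtractf sum_distrib_left N_def)
  also have "\<dots> \<le> 0" using mult_left_mono[OF assms(4), of N] N by simp
  finally show ?thesis by (simp add: sum.distrib sum_negf N_def)
qed

text \<open>A window starting before \<open>n\<close> may run past \<open>n\<close>. Thus every pair
  of a point and a position yields a window, and the frequencies add up to exactly 1 without end
  corrections.\<close>

definition word_freq :: "'a set \<Rightarrow> ('a \<Rightarrow> nat \<Rightarrow> 'l) \<Rightarrow> nat \<Rightarrow> nat \<Rightarrow> 'l list \<Rightarrow> real" where
  "word_freq E s n q u =
     real (card {(x, p) \<in> E \<times> {..<n}. map (s x) [p..<p + q] = u}) / (real (card E) * real n)"

text \<open>Grouping windows by the word they show turns a sum over windows into an expectation.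
  With \<open>h = 1\<close> this gives total mass 1, with minus the logarithm of the frequency it
  gives the entropy of the frequencies.\<close>

lemma sum_over_itineraries:
  fixes h :: "'l list \<Rightarrow> real"
  assumes "finite E" "E \<noteq> {}" "finite L" "\<And>x p. x \<in> E \<Longrightarrow> s x p \<in> L" "0 < n"
  shows "(\<Sum>x\<in>E. \<Sum>p<n. h (map (s x) [p..<p + q]))
    = real (card E) * real n * (\<Sum>u\<in>words L q. word_freq E s n q u * h u)"
proof -
  define w where "w = (\<lambda>(x, p). map (s x) [p..<p + q])"
  have N: "card E > 0" using assms by (simp add: card_gt_0_iff)
  have "(\<Sum>x\<in>E. \<Sum>p<n. h (map (s x) [p..<p + q])) = (\<Sum>y\<in>E \<times> {..<n}. h (w y))"
    by (simp add: sum.cartesian_product w_def case_prod_unfold)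
  also have "\<dots> = (\<Sum>u\<in>words L q. \<Sum>y\<in>{y\<in>E \<times> {..<n}. w y = u}. h (w y))"
    using assms by (intro sum.group[symmetric] finite_words) (auto simp: words_def w_def)
  also have "\<dots> = (\<Sum>u\<in>words L q. real (card {y\<in>E \<times> {..<n}. w y = u}) * h u)"
    by (intro sum.cong refl) simp
  also have "\<dots> = (\<Sum>u\<in>words L q. real (card E) * real n * (word_freq E s n q u * h u))"
    using N assms by (intro sum.cong refl) (simp add: word_freq_def w_def case_prod_unfold mem_Times_iff conj_assoc)
  finally show ?thesis by (simp add: sum_distrib_left)
qed

text \<open>Remainder and quotient by \<open>q\<close> recover \<open>j\<close> and \<open>i\<close>
  from a position, so no position is counted twice.\<close>

lemma sum_arithmetic_progressions_le:
  fixes g :: "nat \<Rightarrow> real"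
  assumes "0 < q" "\<And>j. j < q \<Longrightarrow> j + m j * q \<le> n" "\<And>p. p < n \<Longrightarrow> 0 \<le> g p"
  shows "(\<Sum>j<q. \<Sum>i<m j. g (j + i * q)) \<le> (\<Sum>p<n. g p)"
proof -
  define A where "A = (SIGMA j:{..<q}. {..<m j})"
  define k where "k = (\<lambda>(j, i). j + i * q)"
  have inj: "inj_on k A"
  proof (rule inj_onI, clarify)
    fix j i j' i' assume *: "(j, i) \<in> A" "(j', i') \<in> A" "k (j, i) = k (j', i')"
    then have "(j + i * q) mod q = (j' + i' * q) mod q" "(j + i * q) div q = (j' + i' * q) div q"
      by (auto simp: k_def)
    then show "j = j' \<and> i = i'" using * assms(1) by (auto simp: A_def)
  qed
  have "(\<Sum>j<q. \<Sum>i<m j. g (j + i * q)) = (\<Sum>y\<in>A. g (k y))"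
    unfolding A_def k_def by (subst sum.Sigma) (auto simp: case_prod_unfold)
  also have "\<dots> = (\<Sum>p\<in>k ` A. g p)" using inj by (simp add: sum.reindex)
  also have "\<dots> \<le> (\<Sum>p<n. g p)"
  proof (rule sum_mono2)
    show "k ` A \<subseteq> {..<n}"
    proof (clarsimp simp: A_def k_def)
      fix j i assume "j < q" "i < m j"
      then have "j + i * q < j + m j * q" using assms(1) by simp
      also have "\<dots> \<le> n" using assms(2) \<open>j < q\<close> by simp
      finally show "j + i * q < n" .
    qed
  qed (use assms in auto)
  finally show ?thesis .
qed

text \<open>
  Misiurewicz's block decomposition. For each offset \<open>j < q\<close>, cut an itinerary of length \<open>n\<close> at the
  positions \<open>j, j + q, j + 2 q, \<dots>\<close>; give every complete block its empirical frequency as weight and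
  every remaining letter the uniform weight. This is a probability vector on words of length \<open>n\<close>,
  so Gibbs' inequality bounds \<open>ln (card E)\<close>. Averaging over \<open>j\<close> makes every position in the
  itinerary the start of exactly one block.
\<close>

lemma card_le_block_entropy:
  assumes E: "finite E" "E \<noteq> {}" and L: "finite L" and s: "\<And>x p. x \<in> E \<Longrightarrow> s x p \<in> L"
    and inj: "inj_on (\<lambda>x. map (s x) [0..<n]) E" and q: "0 < q" "q \<le> n"
  shows "real q * ln (real (card E))
    \<le> real n * (- (\<Sum>u\<in>words L q. word_freq E s n q u * ln (word_freq E s n q u)))
      + 2 * real q * real q * ln (real (card L))"
proof -
  define \<nu> where "\<nu> = word_freq E s n q"
  define N where "N = real (card E)"
  define l where "l = card L"
  define w where "w x p = map (s x) [p..<p + q]" for x p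
  have n: "0 < n" using q by simp
  have N: "N > 0" using E by (simp add: N_def card_gt_0_iff)
  have Lne: "L \<noteq> {}" using E s by auto
  then have l: "l \<ge> 1" using L by (simp add: l_def Suc_le_eq card_gt_0_iff)
  note itin = sum_over_itineraries[where s = s and q = q, OF E L s n, folded \<nu>_def N_def]
  have nu1: "(\<Sum>u\<in>words L q. \<nu> u) = 1"
    using itin[where h = "\<lambda>_. 1"] N n by (simp add: N_def)
  have nu_nonneg: "0 \<le> \<nu> u" for u by (simp add: \<nu>_def word_freq_def)
  have w_in: "w x p \<in> words L q" if "x \<in> E" for x p
    using s that by (auto simp: w_def words_def)
  have nu_le: "\<nu> u \<le> 1" if "u \<in> words L q" for u
    using member_le_sum[of u "words L q" \<nu>] that nu_nonneg finite_words[OF L] nu1 by auto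
  \<comment> \<open>Logarithms are taken only of frequencies of words that occur. Positivity is
    needed because \<open>ln\<close> of the product must split and Gibbs' inequality excludes zero
    weights.\<close>
  have nu_pos: "0 < \<nu> (w x p)" if "x \<in> E" "p < n" for x p
  proof -
    define S where "S = {(y, p') \<in> E \<times> {..<n}. map (s y) [p'..<p' + q] = w x p}"
    have "S \<subseteq> E \<times> {..<n}" by (auto simp: S_def)
    then have "finite S" using E by (auto intro: finite_subset)
    moreover have "(x, p) \<in> S" using that by (simp add: S_def w_def)
    ultimately have "card S > 0" by (auto simp: card_gt_0_iff)
    then show ?thesis using N n by (simp add: \<nu>_def word_freq_def N_def S_def)
  qed
  define g where "g x p = - ln (\<nu> (w x p))" for x p
  have g: "0 \<le> g x p" if "x \<in> E" "p < n" for x p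
    using nu_pos[OF that] nu_le[OF w_in] that by (simp add: g_def)
  \<comment> \<open>The number of complete blocks after offset \<open>j\<close>. Fewer than
    \<open>q\<close> letters remain in front and fewer than \<open>q\<close> behind, so the uniform
    letters cost at most \<open>2 * q * ln l\<close> per offset, and summing over \<open>q\<close>
    offsets gives the error term of the statement.\<close>
  define m where "m j = (n - j) div q" for j
  have m: "j + m j * q \<le> n" "n < j + m j * q + q" if "j < q" for j
  proof -
    have "m j * q \<le> n - j" "n - j < m j * q + q"
      unfolding m_def using div_mult_mod_eq[of "n - j" q] mod_less_divisor[OF q(1), of "n - j"]
      by linarith+
    then show "j + m j * q \<le> n" "n < j + m j * q + q" using that q by auto
  qed
  have step: "N * ln N \<le> (\<Sum>x\<in>E. (\<Sum>i<m j. g x (j + i * q)) + 2 * real q * ln (real l))" if j: "j < q" for j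
  proof -
    define r where "r = n - j - m j * q"
    define T where "T u = (1 / real l) ^ j * block_weight \<nu> q l (m j) (drop j u)" for u
    define t where "t x = T (map (s x) [0..<n])" for x
    have n_eq: "n = j + (m j * q + r)" using m[OF j] by (simp add: r_def)
    have r: "r < q" using m[OF j] q by (simp add: r_def)
    have t_eq: "t x = (\<Prod>i<m j. \<nu> (w x (j + i * q))) * (1 / real l) ^ (j + r)" for x
      using block_weight_map[OF m(1)[OF j], of \<nu> l "s x"]
      by (simp add: t_def T_def w_def r_def drop_map drop_upt power_add)
    have lt: "j + i * q < n" if "i < m j" for i
    proof -
      have "j + i * q < j + m j * q" using that q by simp
      also have "\<dots> \<le> n" using m j by simp
      finally show ?thesis .
    qed
    have t_pos: "t x > 0" if "x \<in> E" for x
      unfolding t_eq using l nu_pos[OF that lt] by (intro mult_pos_pos prod_pos) auto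
    have "(\<Sum>u\<in>words L n. T u) = (\<Sum>u\<in>words L j. (1 / real l) ^ j) * (\<Sum>u\<in>words L (m j * q + r). block_weight \<nu> q l (m j) u)"
      unfolding T_def n_eq using sum_words_append[OF L, of "\<lambda>_. (1 / real l) ^ j" j "block_weight \<nu> q l (m j)" "m j * q + r"]
      by simp
    also have "\<dots> = 1"
      unfolding l_def using sum_words_uniform[OF L Lne] sum_block_weight[OF L Lne nu1] by simp
    finally have T1: "(\<Sum>u\<in>words L n. T u) = 1" .
    have bw: "block_weight \<nu> q l k u \<ge> 0" for k u
      by (induction k arbitrary: u) (auto simp: nu_nonneg)
    \<comment> \<open>Distinct points have distinct itineraries, so the weights \<open>t\<close> are
      different entries of the probability vector \<open>T\<close>.\<close>
    have "(\<Sum>x\<in>E. t x) = (\<Sum>u\<in>(\<lambda>x. map (s x) [0..<n]) ` E. T u)"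
      unfolding t_def using inj by (simp add: sum.reindex)
    also have "\<dots> \<le> (\<Sum>u\<in>words L n. T u)"
      using s finite_words[OF L] bw by (intro sum_mono2) (auto simp: words_def T_def)
    finally have "(\<Sum>x\<in>E. t x) \<le> 1" using T1 by simp
    then have "N * ln N \<le> (\<Sum>x\<in>E. - ln (t x))"
      unfolding N_def by (intro gibbs_uniform E t_pos)
    also have "\<dots> \<le> (\<Sum>x\<in>E. (\<Sum>i<m j. g x (j + i * q)) + 2 * real q * ln (real l))"
    proof (rule sum_mono)
      fix x assume x: "x \<in> E"
      have "ln (t x) = ln (\<Prod>i<m j. \<nu> (w x (j + i * q))) + ln ((1 / real l) ^ (j + r))"
        unfolding t_eq using l nu_pos[OF x lt] by (intro ln_mult_pos prod_pos) auto
      also have "ln (\<Prod>i<m j. \<nu> (w x (j + i * q))) = (\<Sum>i<m j. ln (\<nu> (w x (j + i * q))))"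
        using nu_pos[OF x lt] by (intro ln_prod) (auto simp: less_imp_neq[symmetric])
      also have "ln ((1 / real l) ^ (j + r)) = - (real (j + r) * ln (real l))"
        using l by (simp add: ln_realpow ln_div)
      finally have "- ln (t x) = (\<Sum>i<m j. g x (j + i * q)) + real (j + r) * ln (real l)"
        by (simp add: g_def sum_negf)
      moreover have "real (j + r) * ln (real l) \<le> 2 * real q * ln (real l)"
        using j r l by (intro mult_right_mono) auto
      ultimately show "- ln (t x) \<le> (\<Sum>i<m j. g x (j + i * q)) + 2 * real q * ln (real l)" by simp
    qed
    finally show ?thesis .
  qed
  have "real q * (N * ln N) = (\<Sum>j<q. N * ln N)" by simp
  also have "\<dots> \<le> (\<Sum>j<q. \<Sum>x\<in>E. (\<Sum>i<m j. g x (j + i * q)) + 2 * real q * ln (real l))"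
    by (intro sum_mono step) simp
  also have "\<dots> = (\<Sum>x\<in>E. \<Sum>j<q. \<Sum>i<m j. g x (j + i * q)) + N * (2 * real q * real q * ln (real l))"
    by (subst sum.swap) (simp add: sum.distrib N_def)
  also have "(\<Sum>x\<in>E. \<Sum>j<q. \<Sum>i<m j. g x (j + i * q)) \<le> (\<Sum>x\<in>E. \<Sum>p<n. g x p)"
    using q(1) m(1) g by (intro sum_mono sum_arithmetic_progressions_le) auto
  also have "(\<Sum>x\<in>E. \<Sum>p<n. g x p) = N * (real n * (- (\<Sum>u\<in>words L q. \<nu> u * ln (\<nu> u))))"
    using itin[where h = "\<lambda>u. - ln (\<nu> u)"] by (simp add: g_def w_def sum_negf)
  finally have "N * (real q * ln N) \<le> N * (real n * (- (\<Sum>u\<in>words L q. \<nu> u * ln (\<nu> u))) + 2 * real q * real q * ln (real l))"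
    by (simp add: algebra_simps)
  then have "real q * ln N \<le> real n * (- (\<Sum>u\<in>words L q. \<nu> u * ln (\<nu> u))) + 2 * real q * real q * ln (real l)"
    using N by simp
  then show ?thesis by (simp add: N_def \<nu>_def l_def)
qed

subsection \<open>Single-valued maps\<close>

lemma mv_iterate_single: "mv_iterate (\<lambda>x. {f x}) k x = {(f ^^ k) x}"
  by (induction k) auto

lemma large_preimage_single: "large_preimage X (mv_iterate (\<lambda>x. {f x}) k) B = X \<inter> (f ^^ k) -` B"
  by (auto simp: large_preimage_def mv_iterate_single)

lemma funpow_mem: "f ` X \<subseteq> X \<Longrightarrow> x \<in> X \<Longrightarrow> (f ^^ k) x \<in> X"
  by (induction k) auto

definition itinerary :: "('a \<Rightarrow> 'a) \<Rightarrow> ('a \<Rightarrow> 'l) \<Rightarrow> nat \<Rightarrow> 'a \<Rightarrow> 'l list" where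
  "itinerary f lab n x = map (\<lambda>i. lab ((f ^^ i) x)) [0..<n]"

definition cell :: "'a set \<Rightarrow> ('a \<Rightarrow> 'a) \<Rightarrow> ('a \<Rightarrow> 'l) \<Rightarrow> 'l list \<Rightarrow> 'a set" where
  "cell X f lab u = {x \<in> X. itinerary f lab (length u) x = u}"

lemma itinerary_Suc: "itinerary f lab (Suc n) x = lab x # itinerary f lab n (f x)"
  unfolding itinerary_def by (simp only: upt_conv_Cons[OF zero_less_Suc] map_Suc_upt[symmetric])
    (simp add: funpow_swap1)

lemma cell_Nil: "cell X f lab [] = X"
  by (simp add: cell_def itinerary_def)

text \<open>Splitting off the first letter builds cells from label classes by intersections and
  single preimages under \<open>f\<close>, the operations that preserve continuity sets.\<close>

lemma cell_Cons:
  assumes "f ` X \<subseteq> X"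
  shows "cell X f lab (a # u) = {x \<in> X. lab x = a} \<inter> (X \<inter> f -` cell X f lab u)"
  using assms by (auto simp: cell_def itinerary_Suc)

lemma cell_iff: "x \<in> cell X f lab u \<longleftrightarrow> x \<in> X \<and> (\<forall>i<length u. lab ((f ^^ i) x) = u ! i)"
  unfolding cell_def itinerary_def mem_Collect_eq
  by (subst list_eq_iff_nth_eq) simp

lemma funpow_itinerary: "itinerary f lab q ((f ^^ p) x) = map (\<lambda>i. lab ((f ^^ i) x)) [p..<p + q]"
proof (rule nth_equalityI)
  fix i assume "i < length (itinerary f lab q ((f ^^ p) x))"
  moreover have "(f ^^ i) ((f ^^ p) x) = (f ^^ (p + i)) x"
    by (subst add.commute) (simp add: funpow_add)
  ultimately show "itinerary f lab q ((f ^^ p) x) ! i = map (\<lambda>i. lab ((f ^^ i) x)) [p..<p + q] ! i"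
    by (simp add: itinerary_def)
qed (simp add: itinerary_def)

definition label_partition :: "'a set \<Rightarrow> ('a \<Rightarrow> nat) \<Rightarrow> nat \<Rightarrow> 'a set list" where
  "label_partition X lab l = map (\<lambda>i. {x \<in> X. lab x = i}) [0..<l]"

text \<open>Preimages of disjoint sets under a single-valued map are disjoint, so the subtraction in
  \<open>tilde_part\<close> removes nothing and the order of the partition has no effect.\<close>

lemma tilde_part_label_partition:
  assumes "f ` X \<subseteq> X" "j < l"
  shows "tilde_part X (\<lambda>x. {f x}) (label_partition X lab l) k j = {x \<in> X. lab ((f ^^ k) x) = j}"
  using assms funpow_mem[OF assms(1)]
  by (auto simp: tilde_part_def large_preimage_single label_partition_def)

lemma joint_family_label_partition:
  assumes "f ` X \<subseteq> X"
  shows "joint_family X (tilde_partition X (\<lambda>x. {f x}) (label_partition X lab l)) n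
    = cell X f lab ` {u \<in> words {..<l} n. cell X f lab u \<noteq> {}}"
proof -
  let ?T = "tilde_partition X (\<lambda>x. {f x}) (label_partition X lab l)"
  have len: "length (label_partition X lab l) = l" by (simp add: label_partition_def)
  have T: "?T k = (\<lambda>j. {x \<in> X. lab ((f ^^ k) x) = j}) ` {..<l}" for k
    unfolding tilde_partition_def len using tilde_part_label_partition[OF assms, of _ l lab k]
    by (intro image_cong) auto
  show ?thesis
  proof (intro equalityI subsetI)
    fix C assume "C \<in> joint_family X ?T n"
    then obtain Q where Q: "C = X \<inter> (\<Inter>k<n. Q k)" "\<And>k. k < n \<Longrightarrow> Q k \<in> ?T k" "C \<noteq> {}"
      by (auto simp: joint_family_def)
    have "\<exists>j. k < n \<longrightarrow> j < l \<and> Q k = {x \<in> X. lab ((f ^^ k) x) = j}" for k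
      using Q(2)[of k] unfolding T by auto
    then obtain w where w: "\<And>k. k < n \<Longrightarrow> w k < l \<and> Q k = {x \<in> X. lab ((f ^^ k) x) = w k}"
      by metis
    define u where "u = map w [0..<n]"
    have "u \<in> words {..<l} n" using w by (auto simp: u_def words_def)
    moreover have "C = cell X f lab u"
      unfolding Q(1) using w by (auto simp: cell_iff u_def)
    ultimately show "C \<in> cell X f lab ` {u \<in> words {..<l} n. cell X f lab u \<noteq> {}}"
      using Q(3) by blast
  next
    fix C assume "C \<in> cell X f lab ` {u \<in> words {..<l} n. cell X f lab u \<noteq> {}}"
    then obtain u where u: "set u \<subseteq> {..<l}" "length u = n" "C = cell X f lab u" "C \<noteq> {}"
      by (auto simp: words_def)
    define Q where "Q k = {x \<in> X. lab ((f ^^ k) x) = u ! k}" for k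
    have "C = X \<inter> (\<Inter>k<n. Q k)" using u by (auto simp: Q_def cell_iff)
    moreover have "Q k \<in> ?T k" if "k < n" for k
    proof -
      have "u ! k \<in> {..<l}" using subsetD[OF u(1) nth_mem[of k u]] u(2) that by simp
      then show ?thesis unfolding T Q_def by (rule imageI)
    qed
    ultimately show "C \<in> joint_family X ?T n"
      using u(4) unfolding joint_family_def by (intro CollectI exI[of _ Q]) auto
  qed
qed

text \<open>The entropy sums over a family of sets, the right side over words. A nonempty cell
  determines its word, empty cells contribute \<open>0 * ln 0 = 0\<close>, and on measurable cells
  the outer measure is the measure.\<close>

lemma partition_entropy_label_partition:
  assumes f: "f ` X \<subseteq> X" and M: "\<And>u. cell X f lab u \<in> sets M"
  shows "partition_entropy M (joint_family X (tilde_partition X (\<lambda>x. {f x}) (label_partition X lab l)) n)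
    = - (\<Sum>u\<in>words {..<l} n. measure M (cell X f lab u) * ln (measure M (cell X f lab u)))"
proof -
  let ?W = "{u \<in> words {..<l} n. cell X f lab u \<noteq> {}}"
  have inj: "inj_on (cell X f lab) ?W"
  proof (rule inj_onI)
    fix u v assume *: "u \<in> ?W" "v \<in> ?W" "cell X f lab u = cell X f lab v"
    then obtain x where "x \<in> cell X f lab u" "x \<in> cell X f lab v" by auto
    then show "u = v" using * by (auto simp: cell_def words_def)
  qed
  have m: "enn2real (outer_measure_of M (cell X f lab u)) = measure M (cell X f lab u)" for u
    using M[of u] by (simp add: measure_def)
  have "partition_entropy M (joint_family X (tilde_partition X (\<lambda>x. {f x}) (label_partition X lab l)) n)
      = - (\<Sum>u\<in>?W. measure M (cell X f lab u) * ln (measure M (cell X f lab u)))"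
    unfolding partition_entropy_def joint_family_label_partition[OF f] sum.reindex[OF inj] o_def m ..
  also have "(\<Sum>u\<in>?W. measure M (cell X f lab u) * ln (measure M (cell X f lab u)))
      = (\<Sum>u\<in>words {..<l} n. measure M (cell X f lab u) * ln (measure M (cell X f lab u)))"
    by (rule sum.mono_neutral_left) (auto simp: finite_words)
  finally show ?thesis .
qed

lemma ordered_partition_label_partition:
  assumes "space M = X" "\<And>i. {x \<in> X. lab x = i} \<in> sets M" "\<And>x. x \<in> X \<Longrightarrow> lab x < l"
  shows "ordered_partition M (label_partition X lab l)"
proof -
  have "\<Union>(set (label_partition X lab l)) = X"
    using assms(3) by (auto simp: label_partition_def)
  then show ?thesis
    using assms by (auto simp: ordered_partition_def label_partition_def disjoint_family_on_def)
qed

text \<open>Supplies continuity of \<open>x * ln x\<close> at 0. The bound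
  \<open>ln z \<le> z - 1\<close> is used at \<open>z = 1 / sqrt x\<close>; at
  \<open>z = 1 / x\<close> it would give a bound that does not vanish with \<open>x\<close>.\<close>

lemma abs_mult_ln_le:
  fixes x :: real
  assumes "0 \<le> x" "x \<le> 1"
  shows "\<bar>x * ln x\<bar> \<le> 2 * sqrt x"
proof (cases "x = 0")
  case False
  then have x: "0 < x" using assms by simp
  then have "- ln x = 2 * ln (1 / sqrt x)" by (simp add: ln_div ln_sqrt)
  also have "\<dots> \<le> 2 * (1 / sqrt x)"
    using ln_le_minus_one[of "1 / sqrt x"] x by simp
  finally have "x * (- ln x) \<le> x * (2 * (1 / sqrt x))" using x by (intro mult_left_mono) auto
  also have "\<dots> = 2 * (x / sqrt x)" by simp
  also have "\<dots> = 2 * sqrt x" using x by (simp only: real_div_sqrt less_imp_le)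
  finally have "- (x * ln x) \<le> 2 * sqrt x" by simp
  moreover have "x * ln x \<le> 0" using x assms by (simp add: mult_nonneg_nonpos)
  ultimately show ?thesis by simp
qed simp

lemma tendsto_mult_ln:
  fixes g :: "'b \<Rightarrow> real"
  assumes g: "(g \<longlongrightarrow> a) G" and nonneg: "\<And>x. 0 \<le> g x"
  shows "((\<lambda>x. g x * ln (g x)) \<longlongrightarrow> a * ln a) G"
proof (cases "a = 0")
  case False
  then show ?thesis using g by (intro tendsto_intros) auto
next
  case True
  have "eventually (\<lambda>x. g x < 1) G" using order_tendstoD(2)[OF g, of 1] True by simp
  then have "eventually (\<lambda>x. norm (g x * ln (g x)) \<le> 2 * sqrt (g x)) G"
    by eventually_elim (use nonneg abs_mult_ln_le in auto)
  moreover have "((\<lambda>x. sqrt (g x)) \<longlongrightarrow> 0) G"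
    using tendsto_real_sqrt[OF g] unfolding True by simp
  then have "((\<lambda>x. 2 * sqrt (g x)) \<longlongrightarrow> 0) G" by (rule tendsto_mult_right_zero)
  ultimately have "((\<lambda>x. g x * ln (g x)) \<longlongrightarrow> 0) G" by (rule Lim_null_comparison)
  then show ?thesis using True by simp
qed

lemma continuity_set_empty: "continuity_set X M {}"
  unfolding continuity_set_def by (auto intro!: exI[of _ "{}"])

lemma continuity_set_cell:
  assumes M: "M \<in> borel_prob_measures X" and f: "continuous_on X f" "f ` X \<subseteq> X"
    and inv: "\<And>B. B \<in> sets M \<Longrightarrow> emeasure M (X \<inter> f -` B) = emeasure M B"
    and lab: "\<And>i. continuity_set X M {x \<in> X. lab x = i}"
  shows "continuity_set X M (cell X f lab u)"
proof (induction u)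
  case Nil
  then show ?case using continuity_set_Diff[OF M continuity_set_empty] by (simp add: cell_Nil)
next
  case (Cons a u)
  then show ?case unfolding cell_Cons[OF f(2)]
    using assms by (intro continuity_set_Int continuity_set_vimage) auto
qed

text \<open>A finite cover by balls with null spheres is made disjoint by recording the first ball
  that contains a point. Finite intersections and complements keep boundaries null, and radii below
  \<open>e/2\<close> keep points with equal label closer than \<open>e\<close>.\<close>

lemma ex_continuity_labelling:
  fixes X :: "'a::metric_space set"
  assumes X: "compact X" and M: "M \<in> borel_prob_measures X" and "e > 0"
  obtains lab :: "'a \<Rightarrow> nat" and l
  where "\<And>i. continuity_set X M {x \<in> X. lab x = i}" "\<And>x. x \<in> X \<Longrightarrow> lab x < l"
    "\<And>x y. x \<in> X \<Longrightarrow> y \<in> X \<Longrightarrow> lab x = lab y \<Longrightarrow> dist x y < e"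
proof -
  have "\<exists>r. 0 < r \<and> r < e/2 \<and> continuity_set X M (X \<inter> ball x r)" for x
    using ex_continuity_ball[OF M, of "e/2" x] \<open>e > 0\<close> by auto
  then obtain r where r: "\<And>x. 0 < r x" "\<And>x. r x < e/2" "\<And>x. continuity_set X M (X \<inter> ball x (r x))"
    by metis
  have "X \<subseteq> (\<Union>x\<in>X. ball x (r x))" using r(1) by auto
  then obtain C where C: "C \<subseteq> X" "finite C" "X \<subseteq> (\<Union>x\<in>C. ball x (r x))"
    using compactE_image[OF X, of X "\<lambda>x. ball x (r x)"] by (metis open_ball)
  obtain D where D: "set D = C" using finite_list[OF C(2)] by blast
  define B where "B i = ball (D ! i) (r (D ! i))" for i
  define lab where "lab x = (LEAST i. i < length D \<and> x \<in> B i)" for x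
  have ex: "\<exists>i. i < length D \<and> x \<in> B i" if "x \<in> X" for x
    using C(3) that unfolding D[symmetric] B_def by (fastforce simp: in_set_conv_nth)
  have lab: "lab x < length D" "x \<in> B (lab x)" if "x \<in> X" for x
    using LeastI_ex[OF ex[OF that]] by (auto simp: lab_def)
  have lab_eq: "lab x = i \<longleftrightarrow> x \<in> B i \<and> (\<forall>j<i. x \<notin> B j)" if "x \<in> X" "i < length D" for x i
  proof
    assume "lab x = i"
    then show "x \<in> B i \<and> (\<forall>j<i. x \<notin> B j)"
      using lab[OF that(1)] not_less_Least[of _ "\<lambda>i. i < length D \<and> x \<in> B i"]
      by (auto simp: lab_def[symmetric])
  next
    assume "x \<in> B i \<and> (\<forall>j<i. x \<notin> B j)"
    then show "lab x = i" unfolding lab_def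
      using that(2) by (intro Least_equality) (auto simp: not_less[symmetric])
  qed
  define R where "R i = {x \<in> X. \<forall>j<i. x \<notin> B j}" for i
  have R: "continuity_set X M (R i)" for i
  proof (induction i)
    case 0
    then show ?case using continuity_set_Diff[OF M continuity_set_empty] by (simp add: R_def)
  next
    case (Suc i)
    have "R (Suc i) = R i \<inter> (X - (X \<inter> B i))" by (auto simp: R_def less_Suc_eq)
    then show ?case using continuity_set_Int[OF M Suc continuity_set_Diff[OF M r(3)]] by (simp add: B_def)
  qed
  show thesis
  proof
    fix i
    show "continuity_set X M {x \<in> X. lab x = i}"
    proof (cases "i < length D")
      case True
      then have "{x \<in> X. lab x = i} = R i \<inter> (X \<inter> B i)" using lab_eq by (auto simp: R_def)
      then show ?thesis using continuity_set_Int[OF M R r(3)] by (simp add: B_def)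
    next
      case False
      then have "{x \<in> X. lab x = i} = {}" using lab by force
      then show ?thesis by (simp only: continuity_set_empty)
    qed
  next
    fix x y assume xy: "x \<in> X" "y \<in> X" "lab x = lab y"
    define z where "z = D ! lab x"
    have "dist z x < r z" "dist z y < r z" using lab[OF xy(1)] lab[OF xy(2)] xy(3) by (auto simp: B_def z_def)
    then have "dist x y < 2 * r z" using dist_triangle3[of x y z] by simp
    then show "dist x y < e" using r(2)[of z] by simp
  qed (use lab in auto)
qed

section \<open>Empirical averages along orbits\<close>

definition empirical :: "('a \<Rightarrow> 'a) \<Rightarrow> 'a set \<Rightarrow> nat \<Rightarrow> 'a set \<Rightarrow> real" where
  "empirical f E n A = (\<Sum>x\<in>E. \<Sum>p<n. indicator A ((f ^^ p) x)) / (real (card E) * real n)"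

lemma empirical_nonneg: "0 \<le> empirical f E n A"
  by (auto simp: empirical_def intro!: divide_nonneg_nonneg sum_nonneg)

text \<open>Holds also for empty \<open>E\<close> or \<open>n = 0\<close>, where division by zero
  gives 0; the compactness argument needs the bound at every index.\<close>

lemma empirical_le_1: "empirical f E n A \<le> 1"
proof -
  have "(\<Sum>x\<in>E. \<Sum>p<n. indicator A ((f ^^ p) x)) \<le> (\<Sum>x\<in>E. \<Sum>p<n. 1 :: real)"
    by (intro sum_mono) (auto simp: indicator_def)
  then show ?thesis unfolding empirical_def by (intro divide_le_eq_1[THEN iffD2]) (auto simp: zero_less_mult_iff)
qed

lemma empirical_Un: "A \<inter> B = {} \<Longrightarrow> empirical f E n (A \<union> B) = empirical f E n A + empirical f E n B"
  unfolding empirical_def add_divide_distrib[symmetric] sum.distrib[symmetric]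
  by (intro arg_cong2[where f = "(/)"] sum.cong refl) (auto simp: indicator_def)

lemma empirical_space:
  assumes "finite E" "E \<noteq> {}" "0 < n" "E \<subseteq> X" "f ` X \<subseteq> X"
  shows "empirical f E n X = 1"
proof -
  have "(\<Sum>x\<in>E. \<Sum>p<n. indicator X ((f ^^ p) x)) = (\<Sum>x\<in>E. \<Sum>p<n. 1 :: real)"
    using assms funpow_mem[OF assms(5)] by (intro sum.cong refl) (auto simp: indicator_def)
  moreover have "card E > 0" using assms by (simp add: card_gt_0_iff)
  ultimately show ?thesis using assms by (simp add: empirical_def)
qed

text \<open>Shifting an orbit segment by one step changes only its two ends, so the sum telescopes
  to one term of absolute value at most 1 per point of \<open>E\<close>.\<close>

lemma empirical_vimage:
  assumes E: "finite E" "E \<noteq> {}" "E \<subseteq> X" "f ` X \<subseteq> X"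
  shows "\<bar>empirical f E n (X \<inter> f -` A) - empirical f E n A\<bar> \<le> 1 / real n"
proof -
  have "card E > 0" using E by (simp add: card_gt_0_iff)
  define D where "D x = indicator A ((f ^^ n) x) - (indicator A x :: real)" for x
  have "(\<Sum>x\<in>E. \<Sum>p<n. indicator (X \<inter> f -` A) ((f ^^ p) x)) - (\<Sum>x\<in>E. \<Sum>p<n. indicator A ((f ^^ p) x))
      = (\<Sum>x\<in>E. \<Sum>p<n. indicator A ((f ^^ Suc p) x) - indicator A ((f ^^ p) x) :: real)"
    unfolding sum_subtractf[symmetric]
    using E funpow_mem[OF E(4)] by (intro sum.cong refl) (auto simp: indicator_def)
  also have "\<dots> = (\<Sum>x\<in>E. D x)"
    by (subst sum_lessThan_telescope) (simp add: D_def)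
  finally have eq: "empirical f E n (X \<inter> f -` A) - empirical f E n A = (\<Sum>x\<in>E. D x) / (real (card E) * real n)"
    by (simp add: empirical_def diff_divide_distrib[symmetric])
  have "\<bar>\<Sum>x\<in>E. D x\<bar> \<le> (\<Sum>x\<in>E. 1)"
    by (rule order.trans[OF sum_abs sum_mono]) (auto simp: D_def indicator_def)
  then have "\<bar>\<Sum>x\<in>E. D x\<bar> / (real (card E) * real n) \<le> real (card E) / (real (card E) * real n)"
    by (intro divide_right_mono) auto
  then show ?thesis unfolding eq using \<open>card E > 0\<close> by (simp add: abs_divide abs_mult)
qed

text \<open>The window of \<open>x\<close> at position \<open>p\<close> reads \<open>u\<close>
  exactly when the \<open>p\<close>-th iterate of \<open>x\<close> lies in the cell of
  \<open>u\<close>. This links the counting of blocks with the limit measure.\<close>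

lemma word_freq_eq_empirical:
  assumes E: "finite E" "E \<subseteq> X" "f ` X \<subseteq> X"
  shows "word_freq E (\<lambda>x i. lab ((f ^^ i) x)) n (length u) u = empirical f E n (cell X f lab u)"
proof -
  have "real (card {(x, p) \<in> E \<times> {..<n}. map (\<lambda>i. lab ((f ^^ i) x)) [p..<p + length u] = u})
      = (\<Sum>(x, p)\<in>E \<times> {..<n}. indicator (cell X f lab u) ((f ^^ p) x))"
  proof -
    have "{(x, p) \<in> E \<times> {..<n}. map (\<lambda>i. lab ((f ^^ i) x)) [p..<p + length u] = u}
        = {y \<in> E \<times> {..<n}. (f ^^ snd y) (fst y) \<in> cell X f lab u}"
      using E(2) funpow_mem[OF E(3)] by (auto simp: cell_def funpow_itinerary)
    then show ?thesis using E(1)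
      by (simp add: indicator_def case_prod_unfold of_bool_def[symmetric] Int_def mem_Times_iff flip: sum.inter_filter)
  qed
  then show ?thesis
    by (simp add: word_freq_def empirical_def sum.cartesian_product)
qed

lemma inj_on_itinerary:
  assumes "f ` X \<subseteq> X" "E \<subseteq> X"
    and "\<And>x y. x \<in> X \<Longrightarrow> y \<in> X \<Longrightarrow> lab x = lab y \<Longrightarrow> dist x y < e"
    and "\<And>x y. x \<in> E \<Longrightarrow> y \<in> E \<Longrightarrow> x \<noteq> y \<Longrightarrow> \<exists>i<n. dist ((f ^^ i) x) ((f ^^ i) y) > e"
  shows "inj_on (itinerary f lab n) E"
proof (rule inj_onI, rule ccontr)
  fix x y assume xy: "x \<in> E" "y \<in> E" "itinerary f lab n x = itinerary f lab n y" "x \<noteq> y"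
  then obtain i where i: "i < n" "dist ((f ^^ i) x) ((f ^^ i) y) > e" using assms(4) by blast
  have "lab ((f ^^ i) x) = lab ((f ^^ i) y)"
    using arg_cong[OF xy(3), of "\<lambda>u. u ! i"] i by (simp add: itinerary_def)
  then have "dist ((f ^^ i) x) ((f ^^ i) y) < e"
    using assms(2) xy funpow_mem[OF assms(1)] by (intro assms(3)) auto
  then show False using i by simp
qed

text \<open>Misiurewicz's half of the variational principle. The block length \<open>q\<close> stays
  fixed while \<open>k\<close> runs along \<open>G\<close>, so only finitely many cells are involved
  in each limit; \<open>q\<close> grows only afterwards.\<close>

theorem ex_invariant_measure_entropy_ge:
  fixes X :: "'a::metric_space set" and h :: ereal
  assumes X: "compact X" and f: "continuous_on X f" "f ` X \<subseteq> X" and e: "e > 0"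
    and r: "strict_mono r"
    and E: "\<And>k. finite (E k)" "\<And>k. E k \<noteq> {}" "\<And>k. E k \<subseteq> X"
    and sep: "\<And>k x y. x \<in> E k \<Longrightarrow> y \<in> E k \<Longrightarrow> x \<noteq> y \<Longrightarrow> \<exists>i<r k. dist ((f ^^ i) x) ((f ^^ i) y) > e"
    and h: "(\<lambda>k. ereal (ln (real (card (E k))) / real (r k))) \<longlonglongrightarrow> h"
  obtains M where "M \<in> invariant_measures X (\<lambda>x. {f x})" "metric_entropy X (\<lambda>x. {f x}) M \<ge> h"
proof -
  define m where "m k = empirical f (E k) (r k)" for k
  obtain c G where G: "G \<noteq> bot" "G \<le> sequentially" and c: "\<And>A. ((\<lambda>k. m k A) \<longlongrightarrow> c A) G"
    by (rule cluster_point_of_unit_functions[of m]) (auto simp: m_def empirical_nonneg empirical_le_1)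
  have rinf: "filterlim r at_top G"
    by (rule filterlim_mono[OF filterlim_subseq[OF r] order_refl G(2)])
  have rpos: "eventually (\<lambda>k. q \<le> r k) G" for q
    using rinf by (simp add: filterlim_at_top)
  have inv0: "((\<lambda>k. C / real (r k)) \<longlongrightarrow> 0) G" for C :: real
    using filterlim_compose[OF filterlim_real_sequentially rinf]
    by (intro tendsto_divide_0[OF tendsto_const] filterlim_at_top_imp_at_infinity)
  interpret finitely_additive_probability X c
  proof
    show "compact X" by fact
    show "0 \<le> c A" for A
      by (rule tendsto_lowerbound[OF c always_eventually G(1)]) (simp add: m_def empirical_nonneg)
    show "c (A \<union> B) = c A + c B" if "A \<inter> B = {}" for A B
    proof -
      have "((\<lambda>k. m k (A \<union> B)) \<longlongrightarrow> c A + c B) G"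
        unfolding m_def empirical_Un[OF that] using c by (intro tendsto_add) (auto simp: m_def)
      then show ?thesis using c tendsto_unique[OF G(1)] by blast
    qed
    show "c X = 1"
    proof -
      have "eventually (\<lambda>k. m k X = 1) G"
        using rpos[of 1] by eventually_elim (auto simp: m_def intro!: empirical_space E f)
      then have "((\<lambda>k. m k X) \<longlongrightarrow> 1) G" by (rule tendsto_eventually)
      then show ?thesis using c tendsto_unique[OF G(1)] by blast
    qed
  qed
  have c_inv: "c (X \<inter> f -` A) = c A" for A
  proof -
    have "((\<lambda>k. m k (X \<inter> f -` A) - m k A) \<longlongrightarrow> 0) G"
    proof (rule Lim_null_comparison[OF always_eventually inv0[of 1]])
      show "\<forall>k. norm (m k (X \<inter> f -` A) - m k A) \<le> 1 / real (r k)"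
        unfolding m_def using empirical_vimage[OF E f(2)] by auto
    qed
    moreover have "((\<lambda>k. m k (X \<inter> f -` A) - m k A) \<longlongrightarrow> c (X \<inter> f -` A) - c A) G"
      by (intro tendsto_diff c)
    ultimately show ?thesis using tendsto_unique[OF G(1)] by fastforce
  qed
  obtain M where M: "M \<in> borel_prob_measures X"
    and em: "\<And>U. open U \<Longrightarrow> emeasure M (X \<inter> U) = content_open X c U"
    using ex_regular_measure by blast
  have inv: "emeasure M (X \<inter> f -` B) = emeasure M B" if "B \<in> sets M" for B
    by (rule regular_measure_invariant[OF M _ f _ that]) (use em c_inv in auto)
  have "M \<in> invariant_measures X (\<lambda>x. {f x})"
  proof -
    have "emeasure M A \<le> outer_measure_of M (large_preimage X (\<lambda>x. {f x}) A)" if "A \<in> sets M" for A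
    proof -
      have "large_preimage X (\<lambda>x. {f x}) A = X \<inter> f -` A" by (auto simp: large_preimage_def)
      then show ?thesis
        using inv[OF that] preimage_in_sets_borel_prob_measure[OF M f that] by simp
    qed
    then show ?thesis using M by (auto simp: invariant_measures_def)
  qed
  moreover have "metric_entropy X (\<lambda>x. {f x}) M \<ge> h"
  proof -
    obtain lab :: "'a \<Rightarrow> nat" and l where lab: "\<And>i. continuity_set X M {x \<in> X. lab x = i}"
      "\<And>x. x \<in> X \<Longrightarrow> lab x < l"
      "\<And>x y. x \<in> X \<Longrightarrow> y \<in> X \<Longrightarrow> lab x = lab y \<Longrightarrow> dist x y < e"
      by (rule ex_continuity_labelling[OF X M e]) blast
    define H where "H q = - (\<Sum>u\<in>words {..<l} q. measure M (cell X f lab u) * ln (measure M (cell X f lab u)))" for q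
    have cell_cont: "continuity_set X M (cell X f lab u)" for u
      by (rule continuity_set_cell[OF M f]) (use inv lab(1) in auto)
    have cell_measure: "measure M (cell X f lab u) = c (cell X f lab u)" for u
      by (rule regular_measure_continuity_set[OF M _ cell_cont]) (use em in auto)
    define wf where "wf k q u = word_freq (E k) (\<lambda>x i. lab ((f ^^ i) x)) (r k) q u" for k q u
    have wf_lim: "((\<lambda>k. wf k q u) \<longlongrightarrow> measure M (cell X f lab u)) G" if "u \<in> words {..<l} q" for u q
    proof -
      have "wf k q u = m k (cell X f lab u)" for k
        using word_freq_eq_empirical[OF E(1,3) f(2)] that by (auto simp: wf_def m_def words_def)
      then show ?thesis using c cell_measure by simp
    qed
    \<comment> \<open>The block inequality is divided by \<open>q * r k\<close>. Its error term
      becomes \<open>2 * q * ln l / r k\<close> and vanishes along \<open>G\<close>.\<close>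
    have "h \<le> ereal (H q / real q)" if q: "0 < q" for q
    proof (rule tendsto_le[OF G(1)])
      show "((\<lambda>k. ereal (ln (real (card (E k))) / real (r k))) \<longlongrightarrow> h) G"
        by (rule filterlim_mono[OF h order_refl G(2)])
      have "((\<lambda>k. (- (\<Sum>u\<in>words {..<l} q. wf k q u * ln (wf k q u))) / real q + (2 * real q * ln (real l)) / real (r k))
          \<longlongrightarrow> H q / real q + 0) G"
        unfolding H_def using q
        by (intro tendsto_add tendsto_divide tendsto_minus tendsto_sum tendsto_mult_ln wf_lim inv0)
          (auto simp: wf_def word_freq_def)
      then show "((\<lambda>k. ereal ((- (\<Sum>u\<in>words {..<l} q. wf k q u * ln (wf k q u))) / real q + (2 * real q * ln (real l)) / real (r k)))
          \<longlongrightarrow> ereal (H q / real q)) G" by (simp add: lim_ereal)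
      show "eventually (\<lambda>k. ereal (ln (real (card (E k))) / real (r k))
          \<le> ereal ((- (\<Sum>u\<in>words {..<l} q. wf k q u * ln (wf k q u))) / real q + (2 * real q * ln (real l)) / real (r k))) G"
        using rpos[of q]
      proof eventually_elim
        case (elim k)
        have "inj_on (itinerary f lab (r k)) (E k)"
          by (rule inj_on_itinerary[OF f(2) E(3)]) (use lab(3) sep in auto)
        then have inj: "inj_on (\<lambda>x. map (\<lambda>i. lab ((f ^^ i) x)) [0..<r k]) (E k)"
          by (simp add: itinerary_def[abs_def])
        have "real q * ln (real (card (E k)))
            \<le> real (r k) * (- (\<Sum>u\<in>words {..<l} q. wf k q u * ln (wf k q u))) + 2 * real q * real q * ln (real (card {..<l}))"
          unfolding wf_def using lab(2) E(3) funpow_mem[OF f(2)]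
          by (intro card_le_block_entropy[OF E(1,2) finite_lessThan _ inj q elim]) blast
        moreover have "0 < r k" using q elim by simp
        ultimately show ?case using q by (simp add: field_simps)
      qed
    qed
    then have "h \<le> limsup (\<lambda>q. ereal (H q / real q))"
      by (intro le_Limsup) (auto intro!: eventually_sequentiallyI[of 1])
    also have "\<dots> = metric_entropy_wrt X (\<lambda>x. {f x}) M (label_partition X lab l)"
      unfolding metric_entropy_wrt_def H_def
      using cell_cont by (subst partition_entropy_label_partition[OF f(2)]) (auto simp: continuity_set_def)
    also have "\<dots> \<le> metric_entropy X (\<lambda>x. {f x}) M"
      unfolding metric_entropy_def using lab
      by (intro SUP_upper CollectI ordered_partition_label_partition borel_prob_measuresD(3)[OF M])
        (auto simp: continuity_set_def)
    finally show ?thesis .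
  qed
  ultimately show thesis using that by blast
qed

subsection \<open>Separated sets and open covers\<close>

definition separated_set :: "('a::metric_space \<Rightarrow> 'a) \<Rightarrow> nat \<Rightarrow> real \<Rightarrow> 'a set \<Rightarrow> bool" where
  "separated_set f n e E \<longleftrightarrow> (\<forall>x\<in>E. \<forall>y\<in>E. x \<noteq> y \<longrightarrow> (\<exists>i<n. dist ((f ^^ i) x) ((f ^^ i) y) > e))"

text \<open>Two points whose orbits visit the same balls of a finite \<open>e/2\<close>-cover stay
  closer than \<open>e\<close>, so a separated set injects into the words of length \<open>n\<close>
  over the centres.\<close>

lemma separated_set_card_bound:
  assumes X: "compact X" and f: "f ` X \<subseteq> X" and e: "e > 0"
  obtains b where "\<And>E. E \<subseteq> X \<Longrightarrow> separated_set f n e E \<Longrightarrow> finite E \<and> card E \<le> b"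
proof -
  obtain C where C: "finite C" "X \<subseteq> (\<Union>x\<in>C. ball x (e/2))"
    using X e unfolding compact_eq_totally_bounded by (meson half_gt_zero)
  define lab where "lab x = (SOME c. c \<in> C \<and> x \<in> ball c (e/2))" for x
  have lab: "lab x \<in> C" "dist (lab x) x < e/2" if "x \<in> X" for x
  proof -
    have "\<exists>c. c \<in> C \<and> x \<in> ball c (e/2)" using C(2) that by blast
    from someI_ex[OF this] show "lab x \<in> C" "dist (lab x) x < e/2" by (auto simp: lab_def)
  qed
  have close: "dist x y < e" if "x \<in> X" "y \<in> X" "lab x = lab y" for x y
    using lab(2)[OF that(1)] lab(2)[OF that(2)] that(3) dist_triangle3[of x y "lab x"] by simp
  have "finite E \<and> card E \<le> card (words C n)" if E: "E \<subseteq> X" "separated_set f n e E" for E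
  proof -
    have inj: "inj_on (itinerary f lab n) E"
      by (rule inj_on_itinerary[OF f E(1), where e = e]) (use close E(2) in \<open>auto simp: separated_set_def\<close>)
    have "itinerary f lab n ` E \<subseteq> words C n"
      using lab(1)[OF funpow_mem[OF f subsetD[OF E(1)]]] by (auto simp: itinerary_def words_def)
    then show ?thesis
      using inj finite_words[OF C(1)] by (meson card_inj_on_le finite_imageD finite_subset)
  qed
  then show thesis using that by blast
qed

text \<open>A separated set of largest cardinality spans, since a point far from all of it could be
  added. Largest cardinality serves the comparison with \<open>s_CMM\<close>, spanning serves the
  open covers.\<close>

lemma ex_maximal_separated_set:
  assumes "compact X" "f ` X \<subseteq> X" "e > 0" "X \<noteq> {}"
  obtains E where "finite E" "E \<noteq> {}" "E \<subseteq> X" "separated_set f n e E"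
    "\<And>F. F \<subseteq> X \<Longrightarrow> separated_set f n e F \<Longrightarrow> finite F \<and> card F \<le> card E"
    "\<And>y. y \<in> X \<Longrightarrow> \<exists>x\<in>E. \<forall>i<n. dist ((f ^^ i) x) ((f ^^ i) y) \<le> e"
proof -
  obtain b where b: "\<And>E. E \<subseteq> X \<Longrightarrow> separated_set f n e E \<Longrightarrow> finite E \<and> card E \<le> b"
    using separated_set_card_bound[OF assms(1-3), of n] by blast
  let ?P = "\<lambda>E. E \<subseteq> X \<and> separated_set f n e E"
  obtain x0 where x0: "x0 \<in> X" using assms(4) by auto
  then have "?P {x0}" by (auto simp: separated_set_def)
  then obtain E where E: "?P E" "\<And>F. ?P F \<Longrightarrow> card F \<le> card E"
    using ex_has_greatest_nat[of ?P "{x0}" card "Suc b"] b by (auto simp: less_Suc_eq_le)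
  have fin: "finite E" using b E(1) by blast
  have "1 \<le> card E" using E(2)[of "{x0}"] \<open>?P {x0}\<close> by simp
  then have ne: "E \<noteq> {}" by auto
  have span: "\<exists>x\<in>E. \<forall>i<n. dist ((f ^^ i) x) ((f ^^ i) y) \<le> e" if y: "y \<in> X" for y
  proof (rule ccontr)
    assume no: "\<not> (\<exists>x\<in>E. \<forall>i<n. dist ((f ^^ i) x) ((f ^^ i) y) \<le> e)"
    then have far: "\<exists>i<n. dist ((f ^^ i) x) ((f ^^ i) y) > e" if "x \<in> E" for x
      using that by (meson not_le)
    have "y \<notin> E" using no \<open>e > 0\<close> by fastforce
    have "separated_set f n e (insert y E)"
      using E(1) far unfolding separated_set_def by (metis dist_commute insert_iff)
    then have "card (insert y E) \<le> card E" using E y by blast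
    then show False using fin \<open>y \<notin> E\<close> by simp
  qed
  show thesis using that[OF fin ne _ _ _ span] E b by blast
qed

theorem limsup_card_separated_sets_le:
  fixes X :: "'a::metric_space set"
  assumes X: "compact X" and f: "continuous_on X f" "f ` X \<subseteq> X" and e: "e > 0"
    and E: "\<And>n. finite (E n)" "\<And>n. E n \<noteq> {}" "\<And>n. E n \<subseteq> X" "\<And>n. separated_set f n e (E n)"
  shows "limsup (\<lambda>n. ereal (ln (real (card (E n))) / real n))
    \<le> (SUP M \<in> invariant_measures X (\<lambda>x. {f x}). metric_entropy X (\<lambda>x. {f x}) M)"
proof -
  let ?u = "\<lambda>n. ereal (ln (real (card (E n))) / real n)"
  obtain r where r: "strict_mono r" "(?u \<circ> r) \<longlonglongrightarrow> limsup ?u"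
    using limsup_subseq_lim[of ?u] by blast
  obtain M where M: "M \<in> invariant_measures X (\<lambda>x. {f x})" "metric_entropy X (\<lambda>x. {f x}) M \<ge> limsup ?u"
    by (rule ex_invariant_measure_entropy_ge[OF X f e r(1), of "\<lambda>k. E (r k)" "limsup ?u"])
      (use E r(2) in \<open>auto simp: separated_set_def o_def\<close>)
  then show ?thesis by (meson SUP_upper2)
qed

text \<open>\<open>cover_entropy_wrt\<close> is defined by \<open>lim\<close>, which is informative
  only once convergence is known. The limit is the infimum of the quotients.\<close>

lemma fekete_subadditive:
  fixes a :: "nat \<Rightarrow> real"
  assumes nonneg: "\<And>n. 0 \<le> a n" and sub: "\<And>m n. a (m + n) \<le> a m + a n"
  shows "convergent (\<lambda>n. a n / real n)"
proof -
  define L where "L = Inf ((\<lambda>n. a n / real n) ` {1..})"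
  have bdd: "bdd_below ((\<lambda>n. a n / real n) ` {1..})"
    using nonneg by (intro bdd_belowI[of _ 0]) auto
  have lower: "L \<le> a n / real n" if "1 \<le> n" for n
    unfolding L_def using that bdd by (intro cINF_lower) auto
  have mult: "a (q * m + r) \<le> real q * a m + a r" for q m r
  proof (induction q)
    case (Suc q)
    have "a (Suc q * m + r) \<le> a m + a (q * m + r)" using sub[of m "q * m + r"] by (simp add: add.assoc)
    then show ?case using Suc by (simp add: algebra_simps)
  qed simp
  have "(\<lambda>n. a n / real n) \<longlonglongrightarrow> L"
  proof (rule order_tendstoI)
    fix y assume "y < L"
    then show "eventually (\<lambda>n. y < a n / real n) sequentially"
      using lower by (intro eventually_sequentiallyI[of 1]) (auto intro: less_le_trans)
  next
    fix y assume "L < y"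
    then obtain m where m: "1 \<le> m" "a m / real m < y"
      unfolding L_def using bdd by (subst (asm) cINF_less_iff) auto
    \<comment> \<open>Bounds the value at the remainder \<open>n mod m\<close> uniformly in
      \<open>n\<close>, so it disappears after division by \<open>n\<close>.\<close>
    define C where "C = (\<Sum>r<m. a r)"
    have "(\<lambda>n. a m / real m + C / real n) \<longlonglongrightarrow> a m / real m + 0"
      by (intro tendsto_add tendsto_const lim_const_over_n)
    then have "eventually (\<lambda>n. a m / real m + C / real n < y) sequentially"
      using m by (intro order_tendstoD) auto
    then show "eventually (\<lambda>n. a n / real n < y) sequentially"
      using eventually_ge_at_top[of 1]
    proof eventually_elim
      case (elim n)
      have "a (n mod m) \<le> C"
        unfolding C_def using nonneg m by (intro member_le_sum) auto
      then have "a n \<le> real (n div m) * a m + C"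
        using mult[of "n div m" m "n mod m"] by simp
      also have "real (n div m) * a m \<le> real n / real m * a m"
        using nonneg of_nat_div_le_of_nat[of n m] by (intro mult_right_mono) auto
      finally have "a n / real n \<le> (real n / real m * a m + C) / real n"
        by (intro divide_right_mono) auto
      also have "\<dots> = a m / real m + C / real n" using elim by (simp add: field_simps)
      finally show ?case using elim by simp
    qed
  qed
  then show ?thesis by (auto simp: convergent_def)
qed

section \<open>Iterates and iterated covers of a multivalued map\<close>

lemma mv_iterate_subset: "multimap_on X X \<phi> \<Longrightarrow> x \<in> X \<Longrightarrow> mv_iterate \<phi> k x \<subseteq> X"
  by (induction k) (auto simp: multimap_on_def)

lemma mv_iterate_ne: "multimap_on X X \<phi> \<Longrightarrow> x \<in> X \<Longrightarrow> mv_iterate \<phi> k x \<noteq> {}"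
proof (induction k)
  case (Suc k)
  obtain y where y: "y \<in> mv_iterate \<phi> k x"
    using Suc.IH[OF Suc.prems] by (meson ex_in_conv)
  then have "y \<in> X" using mv_iterate_subset[OF Suc.prems, of k] by (rule subsetD[rotated])
  then have "\<phi> y \<noteq> {}" using Suc.prems(1) by (simp add: multimap_on_def)
  then show ?case using y by auto
qed simp

lemma mv_iterate_add: "z \<in> mv_iterate \<phi> m x \<Longrightarrow> mv_iterate \<phi> j z \<subseteq> mv_iterate \<phi> (m + j) x"
  by (induction j) auto

lemma funpow_in_mv_iterate:
  assumes "f ` X \<subseteq> X" "\<And>x. x \<in> X \<Longrightarrow> f x \<in> \<phi> x" "x \<in> X"
  shows "(f ^^ k) x \<in> mv_iterate \<phi> k x"
  using assms funpow_mem[OF assms(1,3)] by (induction k) auto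

lemma iterated_cover_iff:
  "C \<in> iterated_cover X \<phi> \<A> n \<longleftrightarrow>
    (\<exists>A. (\<forall>k<n. A k \<in> \<A>) \<and> C = X \<inter> (\<Inter>k<n. large_preimage X (mv_iterate \<phi> k) (A k)) \<and> C \<noteq> {})"
proof
  assume "C \<in> iterated_cover X \<phi> \<A> n"
  then obtain Q where Q: "C = X \<inter> (\<Inter>k<n. Q k)" "C \<noteq> {}"
    "\<forall>k<n. Q k \<in> large_preimage X (mv_iterate \<phi> k) ` \<A>"
    by (auto simp: iterated_cover_def joint_family_def)
  then have "\<forall>k. \<exists>A. k < n \<longrightarrow> A \<in> \<A> \<and> Q k = large_preimage X (mv_iterate \<phi> k) A" by blast
  then obtain A where "\<forall>k<n. A k \<in> \<A> \<and> Q k = large_preimage X (mv_iterate \<phi> k) (A k)" by metis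
  then show "\<exists>A. (\<forall>k<n. A k \<in> \<A>) \<and> C = X \<inter> (\<Inter>k<n. large_preimage X (mv_iterate \<phi> k) (A k)) \<and> C \<noteq> {}"
    using Q by (intro exI[of _ A]) auto
next
  assume "\<exists>A. (\<forall>k<n. A k \<in> \<A>) \<and> C = X \<inter> (\<Inter>k<n. large_preimage X (mv_iterate \<phi> k) (A k)) \<and> C \<noteq> {}"
  then obtain A where "\<forall>k<n. A k \<in> \<A>" "C = X \<inter> (\<Inter>k<n. large_preimage X (mv_iterate \<phi> k) (A k))" "C \<noteq> {}"
    by blast
  then show "C \<in> iterated_cover X \<phi> \<A> n"
    unfolding iterated_cover_def joint_family_def
    by (intro CollectI exI[of _ "\<lambda>k. large_preimage X (mv_iterate \<phi> k) (A k)"]) auto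
qed

text \<open>One set can arise from several sequences of cover elements. Fixing one sequence per set
  allows sequences from two covers to be concatenated.\<close>

lemma iterated_cover_choice:
  assumes "\<B> \<subseteq> iterated_cover X \<phi> \<A> n"
  obtains A where "\<And>C k. C \<in> \<B> \<Longrightarrow> k < n \<Longrightarrow> A C k \<in> \<A>"
    "\<And>C y k. C \<in> \<B> \<Longrightarrow> y \<in> C \<Longrightarrow> k < n \<Longrightarrow> y \<in> large_preimage X (mv_iterate \<phi> k) (A C k)"
proof -
  define P where "P C A \<longleftrightarrow> (\<forall>k<n. A k \<in> \<A>) \<and> C = X \<inter> (\<Inter>k<n. large_preimage X (mv_iterate \<phi> k) (A k)) \<and> C \<noteq> {}"
    for C A
  have "\<exists>A. P C A" if "C \<in> \<B>" for C
    unfolding P_def by (rule iterated_cover_iff[THEN iffD1, OF subsetD[OF assms that]])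
  then have "P C (SOME A. P C A)" if "C \<in> \<B>" for C by (rule someI_ex[OF _]) (rule that)
  then obtain A where P: "\<And>C. C \<in> \<B> \<Longrightarrow> P C (A C)" by (rule that[of "\<lambda>C. SOME A. P C A"])
  show thesis
  proof
    fix C k assume "C \<in> \<B>" "k < n"
    then show "A C k \<in> \<A>" using P[of C] by (simp add: P_def)
  next
    fix C y k assume *: "C \<in> \<B>" "y \<in> C" "k < n"
    have "C = X \<inter> (\<Inter>k<n. large_preimage X (mv_iterate \<phi> k) (A C k))"
      using P[OF *(1)] unfolding P_def by (elim conjE)
    from subsetD[OF equalityD1[OF this] *(2)] *(3) show "y \<in> large_preimage X (mv_iterate \<phi> k) (A C k)" by simp
  qed
qed

lemma min_subcover_card_le:
  assumes "\<B> \<subseteq> \<C>" "\<Union>\<B> = X" "finite \<B>" "card \<B> \<le> b"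
  shows "min_subcover_card X \<C> \<le> enat b"
proof -
  have "min_subcover_card X \<C> \<le> ecard \<B>"
    unfolding min_subcover_card_def using assms by (intro INF_lower) auto
  also have "\<dots> \<le> enat b" using assms by (simp add: ecard_def)
  finally show ?thesis .
qed

text \<open>A finite infimum in \<open>enat\<close> comes from a nonempty set and is attained by
  well-ordering.\<close>

lemma min_subcover_card_attained:
  assumes "min_subcover_card X \<C> = enat b"
  obtains \<B> where "\<B> \<subseteq> \<C>" "\<Union>\<B> = X" "finite \<B>" "card \<B> = b"
proof -
  define S where "S = ecard ` {\<B>. \<B> \<subseteq> \<C> \<and> \<Union>\<B> = X}"
  have S: "Inf S = enat b" using assms by (simp only: S_def min_subcover_card_def)
  then have "S \<noteq> {}" by (auto simp: Inf_enat_def)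
  then have "Inf S \<in> S" unfolding Inf_enat_def by (metis LeastI ex_in_conv)
  then have "enat b \<in> S" unfolding S .
  then obtain \<B> where "enat b = ecard \<B>" "\<B> \<in> {\<B>. \<B> \<subseteq> \<C> \<and> \<Union>\<B> = X}"
    unfolding S_def by (rule imageE)
  then show thesis by (intro that[of \<B>]) (simp_all add: ecard_def split: if_splits)
qed

lemma min_subcover_card_pos:
  assumes "X \<noteq> {}" "min_subcover_card X \<C> = enat b"
  shows "1 \<le> b"
proof -
  obtain \<B> where "\<B> \<subseteq> \<C>" "\<Union>\<B> = X" "finite \<B>" "card \<B> = b"
    using min_subcover_card_attained[OF assms(2)] .
  moreover have "\<B> \<noteq> {}" using \<open>\<Union>\<B> = X\<close> assms(1) by auto
  ultimately show ?thesis by (auto simp: Suc_le_eq card_gt_0_iff)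
qed

lemma iterated_cover_submultiplicative:
  assumes \<phi>: "multimap_on X X \<phi>"
    and m: "min_subcover_card X (iterated_cover X \<phi> \<A> m) = enat b"
    and n: "min_subcover_card X (iterated_cover X \<phi> \<A> n) = enat d"
  shows "min_subcover_card X (iterated_cover X \<phi> \<A> (m + n)) \<le> enat (b * d)"
proof -
  let ?pre = "\<lambda>k. large_preimage X (mv_iterate \<phi> k)"
  obtain \<B> where B: "\<B> \<subseteq> iterated_cover X \<phi> \<A> m" "\<Union>\<B> = X" "finite \<B>" "card \<B> = b"
    using min_subcover_card_attained[OF m] .
  obtain \<D> where D: "\<D> \<subseteq> iterated_cover X \<phi> \<A> n" "\<Union>\<D> = X" "finite \<D>" "card \<D> = d"
    using min_subcover_card_attained[OF n] .
  obtain A where A: "\<And>C k. C \<in> \<B> \<Longrightarrow> k < m \<Longrightarrow> A C k \<in> \<A>"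
    "\<And>C y k. C \<in> \<B> \<Longrightarrow> y \<in> C \<Longrightarrow> k < m \<Longrightarrow> y \<in> ?pre k (A C k)"
    by (rule iterated_cover_choice[OF B(1)]) (rule that)
  obtain A' where A': "\<And>C k. C \<in> \<D> \<Longrightarrow> k < n \<Longrightarrow> A' C k \<in> \<A>"
    "\<And>C y k. C \<in> \<D> \<Longrightarrow> y \<in> C \<Longrightarrow> k < n \<Longrightarrow> y \<in> ?pre k (A' C k)"
    by (rule iterated_cover_choice[OF D(1)]) (rule that)
  define W where "W C C' k = (if k < m then A C k else A' C' (k - m))" for C C' k
  define J where "J = (\<lambda>(C, C'). X \<inter> (\<Inter>k<m + n. ?pre k (W C C' k)))"
  \<comment> \<open>An iterated cover has only nonempty members, so incompatible pairs are
    dropped.\<close>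
  define \<E> where "\<E> = J ` (\<B> \<times> \<D>) - {{}}"
  show ?thesis
  proof (rule min_subcover_card_le)
    show "\<E> \<subseteq> iterated_cover X \<phi> \<A> (m + n)"
    proof
      fix S assume "S \<in> \<E>"
      then obtain C C' where C: "C \<in> \<B>" "C' \<in> \<D>" "S = J (C, C')" "S \<noteq> {}" by (auto simp: \<E>_def)
      have "\<forall>k<m + n. W C C' k \<in> \<A>" using A(1)[OF C(1)] A'(1)[OF C(2)] by (auto simp: W_def)
      then show "S \<in> iterated_cover X \<phi> \<A> (m + n)"
        unfolding iterated_cover_iff using C by (intro exI[of _ "W C C'"]) (auto simp: J_def)
    qed
    show "finite \<E>" using B D by (simp add: \<E>_def)
    have "card \<E> \<le> card (J ` (\<B> \<times> \<D>))" unfolding \<E>_def using B D by (intro card_mono) auto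
    also have "\<dots> \<le> card (\<B> \<times> \<D>)" using B D by (intro card_image_le) auto
    finally show "card \<E> \<le> b * d" using B D by (simp add: card_cartesian_product)
    show "\<Union>\<E> = X"
    proof
      show "\<Union>\<E> \<subseteq> X" by (auto simp: \<E>_def J_def)
      show "X \<subseteq> \<Union>\<E>"
      proof
        fix y assume y: "y \<in> X"
        then obtain C where C: "C \<in> \<B>" "y \<in> C" using B(2) by blast
        obtain z where z: "z \<in> mv_iterate \<phi> m y" using mv_iterate_ne[OF \<phi> y] by blast
        then have "z \<in> X" using mv_iterate_subset[OF \<phi> y] by blast
        then obtain C' where C': "C' \<in> \<D>" "z \<in> C'" using D(2) by blast
        have "y \<in> ?pre k (W C C' k)" if "k < m + n" for k
        proof (cases "k < m")
          case True
          then show ?thesis using A(2)[OF C] by (simp add: W_def)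
        next
          case False
          then have "z \<in> ?pre (k - m) (A' C' (k - m))" using A'(2)[OF C'] that by simp
          then have "mv_iterate \<phi> (k - m) z \<inter> A' C' (k - m) \<noteq> {}" by (simp add: large_preimage_def)
          moreover have "mv_iterate \<phi> (k - m) z \<subseteq> mv_iterate \<phi> k y"
            using mv_iterate_add[OF z, of "k - m"] False by simp
          ultimately show ?thesis using y False by (auto simp: large_preimage_def W_def)
        qed
        then have "y \<in> J (C, C')" using y by (auto simp: J_def)
        then show "y \<in> \<Union>\<E>" using C C' by (auto simp: \<E>_def)
      qed
    qed
  qed
qed

text \<open>The orbit under \<open>f\<close> of a spanning point names one cover element per time.
  Points that shadow this orbit lie in the resulting member of the iterated cover of
  \<open>\<phi>\<close>, so a spanning set yields a subcover.\<close>

lemma cover_entropy_le: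
  fixes X :: "'a::metric_space set"
  assumes X: "compact X" "X \<noteq> {}" and \<phi>: "multimap_on X X \<phi>"
    and f: "continuous_on X f" "f ` X \<subseteq> X" "\<And>x. x \<in> X \<Longrightarrow> f x \<in> \<phi> x"
  shows "cover_entropy X \<phi> \<le> (SUP M \<in> invariant_measures X (\<lambda>x. {f x}). metric_entropy X (\<lambda>x. {f x}) M)"
    (is "_ \<le> ?S")
  unfolding cover_entropy_def
proof (rule SUP_least, clarify)
  fix \<A> assume \<A>: "open_cover X \<A>"
  \<comment> \<open>The cover is only open relative to \<open>X\<close>; its members are lifted to
    open sets of the whole space to obtain a Lebesgue number \<open>e\<close>. Spanning at scale
    \<open>e/2\<close> then puts points into open balls of radius \<open>e\<close>.\<close>
  define \<G> where "\<G> = {T. open T \<and> X \<inter> T \<in> \<A>}"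
  have "X \<subseteq> \<Union>\<G>"
  proof
    fix x assume "x \<in> X"
    then obtain A where "A \<in> \<A>" "x \<in> A" using \<A> by (auto simp: open_cover_def)
    moreover from this obtain T where "open T" "A = X \<inter> T"
      using \<A> by (auto simp: open_cover_def openin_open)
    ultimately show "x \<in> \<Union>\<G>" by (auto simp: \<G>_def)
  qed
  then obtain e where e: "0 < e" "\<And>x. x \<in> X \<Longrightarrow> \<exists>G\<in>\<G>. ball x e \<subseteq> G"
    by (rule Heine_Borel_lemma[OF X(1)]) (auto simp: \<G>_def)
  have "\<exists>A. A \<in> \<A> \<and> X \<inter> ball x e \<subseteq> A" if "x \<in> X" for x
    using e(2)[OF that] by (auto simp: \<G>_def)
  then obtain U where U: "\<And>x. x \<in> X \<Longrightarrow> U x \<in> \<A> \<and> X \<inter> ball x e \<subseteq> U x" by metis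
  have "\<exists>E. finite E \<and> E \<noteq> {} \<and> E \<subseteq> X \<and> separated_set f n (e/2) E \<and>
      (\<forall>y\<in>X. \<exists>x\<in>E. \<forall>i<n. dist ((f ^^ i) x) ((f ^^ i) y) \<le> e/2)" for n
    by (rule ex_maximal_separated_set[OF X(1) f(2) half_gt_zero[OF e(1)] X(2), of n]) blast
  then obtain E where E: "\<And>n. finite (E n)" "\<And>n. E n \<noteq> {}" "\<And>n. E n \<subseteq> X" "\<And>n. separated_set f n (e/2) (E n)"
    "\<And>n y. y \<in> X \<Longrightarrow> \<exists>x\<in>E n. \<forall>i<n. dist ((f ^^ i) x) ((f ^^ i) y) \<le> e/2"
    by metis
  let ?N = "\<lambda>n. min_subcover_card X (iterated_cover X \<phi> \<A> n)"
  have N_le: "?N n \<le> enat (card (E n))" for n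
  proof -
    define C where "C x = X \<inter> (\<Inter>k<n. large_preimage X (mv_iterate \<phi> k) (U ((f ^^ k) x)))" for x
    have mem: "y \<in> C x" if "x \<in> X" "y \<in> X" "\<forall>i<n. dist ((f ^^ i) x) ((f ^^ i) y) \<le> e/2" for x y
    proof -
      have "y \<in> large_preimage X (mv_iterate \<phi> k) (U ((f ^^ k) x))" if "k < n" for k
      proof -
        have "(f ^^ k) y \<in> ball ((f ^^ k) x) e"
          using \<open>\<forall>i<n. _\<close> that e(1) by (auto intro: le_less_trans[of _ "e/2"])
        then have "(f ^^ k) y \<in> U ((f ^^ k) x)"
          using U funpow_mem[OF f(2)] \<open>x \<in> X\<close> \<open>y \<in> X\<close> by blast
        moreover have "(f ^^ k) y \<in> mv_iterate \<phi> k y"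
          by (rule funpow_in_mv_iterate[OF f(2,3) \<open>y \<in> X\<close>])
        ultimately show ?thesis using \<open>y \<in> X\<close> by (auto simp: large_preimage_def)
      qed
      then show ?thesis using \<open>y \<in> X\<close> by (simp add: C_def)
    qed
    show ?thesis
    proof (rule min_subcover_card_le)
      show "C ` E n \<subseteq> iterated_cover X \<phi> \<A> n"
      proof clarify
        fix x assume "x \<in> E n"
        then have x: "x \<in> X" using E(3) by blast
        then have "x \<in> C x" using mem[OF x x] e(1) by simp
        then show "C x \<in> iterated_cover X \<phi> \<A> n"
          unfolding iterated_cover_iff using U funpow_mem[OF f(2) x]
          by (intro exI[of _ "\<lambda>k. U ((f ^^ k) x)"]) (auto simp: C_def)
      qed
      show "\<Union>(C ` E n) = X"
      proof
        show "\<Union>(C ` E n) \<subseteq> X" by (auto simp: C_def)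
        show "X \<subseteq> \<Union>(C ` E n)"
        proof
          fix y assume y: "y \<in> X"
          then obtain x where x: "x \<in> E n" "\<forall>i<n. dist ((f ^^ i) x) ((f ^^ i) y) \<le> e/2"
            using E(5)[of y n] by blast
          then have "y \<in> C x" using mem y E(3)[of n] by blast
          then show "y \<in> \<Union>(C ` E n)" using x by blast
        qed
      qed
    qed (use E(1) in \<open>auto intro: card_image_le\<close>)
  qed
  then have "\<exists>k. ?N n = enat k" for n by (metis enat_ile)
  then obtain N where N: "\<And>n. ?N n = enat (N n)" by metis
  have N1: "1 \<le> N n" for n by (rule min_subcover_card_pos[OF X(2) N])
  have N_le': "N n \<le> card (E n)" for n using N_le[of n] by (simp add: N)
  have "N (m + n) \<le> N m * N n" for m n
    using iterated_cover_submultiplicative[OF \<phi> N N, of m n] by (simp add: N)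
  then have "ln (real (N (m + n))) \<le> ln (real (N m)) + ln (real (N n))" for m n
  proof -
    have "real (N (m + n)) \<le> real (N m) * real (N n)"
      using \<open>N (m + n) \<le> N m * N n\<close> by (metis of_nat_le_iff of_nat_mult)
    moreover have "0 < real (N (m + n))" "0 < real (N m)" "0 < real (N n)"
      using N1[of "m + n"] N1[of m] N1[of n] by auto
    ultimately show ?thesis by (subst ln_mult_pos[symmetric]) (auto intro!: ln_mono)
  qed
  then have "convergent (\<lambda>n. ln (real (N n)) / real n)"
    using N1 by (intro fekete_subadditive) auto
  then obtain L where L: "(\<lambda>n. ln (real (N n)) / real n) \<longlonglongrightarrow> L" by (auto simp: convergent_def)
  have eq: "elog (?N n) / ereal (real n) = ereal (ln (real (N n)) / real n)" if "1 \<le> n" for n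
    using N1[of n] that by (simp add: N elog_def)
  have L': "(\<lambda>n. ereal (ln (real (N n)) / real n)) \<longlonglongrightarrow> ereal L" using L by simp
  have "(\<lambda>n. elog (?N n) / ereal (real n)) \<longlonglongrightarrow> ereal L"
    by (rule Lim_transform_eventually[OF L']) (use eq in \<open>auto intro!: eventually_sequentiallyI[of 1]\<close>)
  then have "cover_entropy_wrt X \<phi> \<A> = ereal L" unfolding cover_entropy_wrt_def by (rule limI)
  also have "ereal L = limsup (\<lambda>n. ereal (ln (real (N n)) / real n))"
    using lim_imp_Limsup[OF _ L'] by simp
  also have "\<dots> \<le> limsup (\<lambda>n. ereal (ln (real (card (E n))) / real n))"
  proof (intro Limsup_mono always_eventually allI)
    fix n
    have "ln (real (N n)) \<le> ln (real (card (E n)))" using N1[of n] N_le'[of n] by (intro ln_mono) auto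
    then show "ereal (ln (real (N n)) / real n) \<le> ereal (ln (real (card (E n))) / real n)"
      by (simp add: divide_right_mono)
  qed
  also have "\<dots> \<le> ?S"
    by (rule limsup_card_separated_sets_le[OF X(1) f(1,2) half_gt_zero[OF e(1)] E(1-4)])
  finally show "cover_entropy_wrt X \<phi> \<A> \<le> ?S" .
qed

subsection \<open>Entropies of a multivalued map\<close>

lemma dist_CMM_le:
  assumes "xs \<in> orbits X \<phi> n x" "ys \<in> orbits X \<phi> n y" "0 < n"
  shows "dist_CMM X \<phi> n x y \<le> (MAX i\<in>{..<n}. dist (xs ! i) (ys ! i))"
proof -
  \<comment> \<open>A real infimum needs a lower bound, and \<open>0 < n\<close> keeps
    \<open>Max\<close> off the empty set.\<close>
  have nonneg: "0 \<le> (MAX i\<in>{..<n}. dist (us ! i) (vs ! i))" for us vs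
    by (rule order.trans[OF zero_le_dist Max_ge[of _ "dist (us ! 0) (vs ! 0)"]]) (use assms(3) in auto)
  have "bdd_below ((\<lambda>(us, vs). MAX i\<in>{..<n}. dist (us ! i) (vs ! i)) ` (orbits X \<phi> n x \<times> orbits X \<phi> n y))"
    using nonneg by (intro bdd_belowI[of _ 0]) auto
  then show ?thesis
    unfolding dist_CMM_def
    using cINF_lower[of "\<lambda>(us, vs). MAX i\<in>{..<n}. dist (us ! i) (vs ! i)" "orbits X \<phi> n x \<times> orbits X \<phi> n y" "(xs, ys)"] assms(1,2)
    by simp
qed

lemma dist_CMM_commute: "dist_CMM X \<phi> n x y = dist_CMM X \<phi> n y x"
proof -
  let ?D = "\<lambda>(xs, ys). MAX i\<in>{..<n}. dist (xs ! i) (ys ! i)"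
  have "?D ` (orbits X \<phi> n y \<times> orbits X \<phi> n x) = ?D ` (prod.swap ` (orbits X \<phi> n x \<times> orbits X \<phi> n y))"
    by (simp only: product_swap)
  also have "\<dots> = ?D ` (orbits X \<phi> n x \<times> orbits X \<phi> n y)"
    unfolding image_image by (rule image_cong) (auto simp: dist_commute)
  finally have "?D ` (orbits X \<phi> n x \<times> orbits X \<phi> n y) = ?D ` (orbits X \<phi> n y \<times> orbits X \<phi> n x)" ..
  then show ?thesis by (simp add: dist_CMM_def)
qed

lemma selection_orbit:
  assumes "f ` X \<subseteq> X" "\<And>x. x \<in> X \<Longrightarrow> f x \<in> \<phi> x" "x \<in> X" "0 < n"
  shows "map (\<lambda>i. (f ^^ i) x) [0..<n] \<in> orbits X \<phi> n x"
  using assms funpow_mem[OF assms(1,3)] by (auto simp: orbits_def)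

lemma dist_CMM_le_selection:
  assumes f: "f ` X \<subseteq> X" "\<And>x. x \<in> X \<Longrightarrow> f x \<in> \<phi> x" and xy: "x \<in> X" "y \<in> X" and n: "0 < n"
  obtains i where "i < n" "dist_CMM X \<phi> n x y \<le> dist ((f ^^ i) x) ((f ^^ i) y)"
proof -
  let ?D = "(\<lambda>i. dist ((f ^^ i) x) ((f ^^ i) y)) ` {..<n}"
  have "dist_CMM X \<phi> n x y \<le> (MAX i\<in>{..<n}. dist (map (\<lambda>i. (f ^^ i) x) [0..<n] ! i) (map (\<lambda>i. (f ^^ i) y) [0..<n] ! i))"
    by (intro dist_CMM_le selection_orbit f xy n)
  also have "\<dots> = Max ?D" by (intro arg_cong[where f = Max] image_cong) auto
  finally have "dist_CMM X \<phi> n x y \<le> Max ?D" .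
  moreover have "Max ?D \<in> ?D" using n by (intro Max_in) auto
  ultimately show thesis using that by auto
qed

text \<open>The infimum over all pairs of orbits is at most the value on the two orbits of
  \<open>f\<close>, so the scale \<open>e\<close> is kept.\<close>

lemma separated_CMM_imp_separated_set:
  assumes f: "f ` X \<subseteq> X" "\<And>x. x \<in> X \<Longrightarrow> f x \<in> \<phi> x" and S: "separated_CMM X \<phi> e n S" and n: "0 < n"
  shows "separated_set f n e S"
  unfolding separated_set_def
proof (intro ballI impI)
  fix x y assume xy: "x \<in> S" "y \<in> S" "x \<noteq> y"
  then have "x \<in> X" "y \<in> X" "e < dist_CMM X \<phi> n x y" using S by (auto simp: separated_CMM_def)
  then show "\<exists>i<n. dist ((f ^^ i) x) ((f ^^ i) y) > e"
    using dist_CMM_le_selection[OF f, of x y n] n by (metis less_le_trans)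
qed

lemma elog_mono: "a \<le> b \<Longrightarrow> elog a \<le> elog b"
  by (cases a; cases b) (auto simp: elog_def)

lemma s_CMM_le:
  assumes "\<And>S. separated_CMM X \<phi> e n S \<Longrightarrow> finite S \<and> card S \<le> b"
  shows "s_CMM X \<phi> e n \<le> enat b"
  unfolding s_CMM_def using assms by (intro SUP_least) (auto simp: ecard_def)

text \<open>The usual maximality argument survives although \<open>dist_CMM\<close> may violate the
  triangle inequality: it needs only symmetry and a small distance from a point to itself. Separated
  sets of \<open>f\<close> bound the cardinalities, so a maximum exists.\<close>

lemma r_CMM_le_s_CMM:
  assumes f: "f ` X \<subseteq> X" "\<And>x. x \<in> X \<Longrightarrow> f x \<in> \<phi> x" and X: "compact X" and e: "e > 0" and n: "0 < n"
  shows "r_CMM X \<phi> e n \<le> s_CMM X \<phi> e n"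
proof -
  obtain b where "\<And>E. E \<subseteq> X \<Longrightarrow> separated_set f n e E \<Longrightarrow> finite E \<and> card E \<le> b"
    using separated_set_card_bound[OF X f(1) e, of n] by blast
  then have b: "finite S \<and> card S \<le> b" if "separated_CMM X \<phi> e n S" for S
    using separated_CMM_imp_separated_set[OF f that n] that by (simp add: separated_CMM_def)
  have "separated_CMM X \<phi> e n {}" by (simp add: separated_CMM_def)
  then obtain S where S: "separated_CMM X \<phi> e n S" "\<And>T. separated_CMM X \<phi> e n T \<Longrightarrow> card T \<le> card S"
    using ex_has_greatest_nat[of "separated_CMM X \<phi> e n" "{}" card "Suc b"] b by (auto simp: less_Suc_eq_le)
  have "spanning_CMM X \<phi> e n S"
    unfolding spanning_CMM_def
  proof (intro conjI ballI)
    show "S \<subseteq> X" using S(1) by (simp add: separated_CMM_def)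
    fix y assume y: "y \<in> X"
    show "\<exists>x\<in>S. dist_CMM X \<phi> n x y \<le> e"
    proof (rule ccontr)
      assume no: "\<not> (\<exists>x\<in>S. dist_CMM X \<phi> n x y \<le> e)"
      obtain i where "dist_CMM X \<phi> n y y \<le> dist ((f ^^ i) y) ((f ^^ i) y)"
        using dist_CMM_le_selection[OF f y y n] .
      then have "dist_CMM X \<phi> n y y \<le> e" using e by simp
      then have "y \<notin> S" using no by blast
      have far: "e < dist_CMM X \<phi> n x y" "e < dist_CMM X \<phi> n y x" if "x \<in> S" for x
        using no that dist_CMM_commute[of X \<phi> n x y] by (auto simp: not_le)
      have "separated_CMM X \<phi> e n (insert y S)"
        using S(1) y far by (auto simp: separated_CMM_def)
      then have "card (insert y S) \<le> card S" by (rule S(2))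
      then show False using b[OF S(1)] \<open>y \<notin> S\<close> by simp
    qed
  qed
  then have "r_CMM X \<phi> e n \<le> ecard S" unfolding r_CMM_def by (intro INF_lower) simp
  also have "\<dots> \<le> s_CMM X \<phi> e n" unfolding s_CMM_def using S(1) by (intro SUP_upper) simp
  finally show ?thesis .
qed

lemma h_span_CMM_le_h_sep_CMM:
  assumes f: "f ` X \<subseteq> X" "\<And>x. x \<in> X \<Longrightarrow> f x \<in> \<phi> x" and X: "compact X"
  shows "h_span_CMM X \<phi> \<le> h_sep_CMM X \<phi>"
  unfolding h_span_CMM_def h_sep_CMM_def
proof (rule SUP_mono)
  fix e :: real assume e: "e \<in> {0<..}"
  have "limsup (\<lambda>n. elog (r_CMM X \<phi> e n) / ereal (real n)) \<le> limsup (\<lambda>n. elog (s_CMM X \<phi> e n) / ereal (real n))"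
    using e by (intro Limsup_mono eventually_sequentiallyI[of 1] ereal_divide_right_mono elog_mono
        r_CMM_le_s_CMM[OF f X]) auto
  then show "\<exists>e'\<in>{0<..}. limsup (\<lambda>n. elog (r_CMM X \<phi> e n) / ereal (real n)) \<le> limsup (\<lambda>n. elog (s_CMM X \<phi> e' n) / ereal (real n))"
    using e by blast
qed

text \<open>The measure obtained from \<open>f\<close> may depend on the scale \<open>e\<close>, so
  the bound is by the supremum over measures, not by a single one.\<close>

lemma h_sep_CMM_le:
  fixes X :: "'a::metric_space set"
  assumes X: "compact X" "X \<noteq> {}" and f: "continuous_on X f" "f ` X \<subseteq> X" "\<And>x. x \<in> X \<Longrightarrow> f x \<in> \<phi> x"
  shows "h_sep_CMM X \<phi> \<le> (SUP M \<in> invariant_measures X (\<lambda>x. {f x}). metric_entropy X (\<lambda>x. {f x}) M)"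
    (is "_ \<le> ?S")
  unfolding h_sep_CMM_def
proof (rule SUP_least)
  fix e :: real assume "e \<in> {0<..}"
  then have e: "e > 0" by simp
  have "\<exists>E. finite E \<and> E \<noteq> {} \<and> E \<subseteq> X \<and> separated_set f n e E \<and>
      (\<forall>F. F \<subseteq> X \<longrightarrow> separated_set f n e F \<longrightarrow> finite F \<and> card F \<le> card E)" for n
    by (rule ex_maximal_separated_set[OF X(1) f(2) e X(2), of n]) blast
  then obtain E where E: "\<And>n. finite (E n)" "\<And>n. E n \<noteq> {}" "\<And>n. E n \<subseteq> X" "\<And>n. separated_set f n e (E n)"
    "\<And>n F. F \<subseteq> X \<Longrightarrow> separated_set f n e F \<Longrightarrow> finite F \<and> card F \<le> card (E n)"
    by metis
  have "limsup (\<lambda>n. elog (s_CMM X \<phi> e n) / ereal (real n)) \<le> limsup (\<lambda>n. ereal (ln (real (card (E n))) / real n))"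
  proof (intro Limsup_mono eventually_sequentiallyI[of 1])
    fix n :: nat assume n: "1 \<le> n"
    have "s_CMM X \<phi> e n \<le> enat (card (E n))"
    proof (rule s_CMM_le)
      fix S assume S: "separated_CMM X \<phi> e n S"
      then have "separated_set f n e S" using separated_CMM_imp_separated_set[OF f(2,3) S] n by simp
      then show "finite S \<and> card S \<le> card (E n)" using S by (intro E(5)) (simp_all add: separated_CMM_def)
    qed
    then have "elog (s_CMM X \<phi> e n) / ereal (real n) \<le> elog (enat (card (E n))) / ereal (real n)"
      using n by (intro ereal_divide_right_mono elog_mono) auto
    also have "\<dots> = ereal (ln (real (card (E n))) / real n)"
      using E(1,2)[of n] n by (simp add: elog_def card_eq_0_iff)
    finally show "elog (s_CMM X \<phi> e n) / ereal (real n) \<le> ereal (ln (real (card (E n))) / real n)" .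
  qed
  also have "\<dots> \<le> ?S"
    by (rule limsup_card_separated_sets_le[OF X(1) f(1,2) e E(1-4)])
  finally show "limsup (\<lambda>n. elog (s_CMM X \<phi> e n) / ereal (real n)) \<le> ?S" .
qed

text \<open>For the empty space, which carries no probability measure: the supremum over measures is
  then minus infinity, and the topological entropies must be so too. The case \<open>n = 0\<close>
  is included, because the inverse of 0 in \<open>ereal\<close> is infinite.\<close>

lemma elog_0_divide: "elog 0 / ereal (real n) = - \<infinity>"
  by (simp add: elog_def zero_enat_def)

lemma h_sep_CMM_empty: "h_sep_CMM {} \<phi> = - \<infinity>"
proof -
  have "s_CMM {} \<phi> e n = 0" for e n
  proof -
    have "{S. separated_CMM {} \<phi> e n S} = {{}}" by (auto simp: separated_CMM_def)
    then show ?thesis by (simp add: s_CMM_def ecard_def zero_enat_def)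
  qed
  then show ?thesis by (simp add: h_sep_CMM_def elog_0_divide Limsup_const)
qed

lemma cover_entropy_empty: "cover_entropy {} \<phi> = - \<infinity>"
proof -
  have "min_subcover_card {} (iterated_cover {} \<phi> \<A> n) \<le> enat 0" for \<A> n
    by (rule min_subcover_card_le[of "{}"]) auto
  then have "min_subcover_card {} (iterated_cover {} \<phi> \<A> n) = 0" for \<A> n
    by (simp add: zero_enat_def[symmetric])
  then have "cover_entropy_wrt {} \<phi> \<A> = - \<infinity>" for \<A>
    unfolding cover_entropy_wrt_def by (simp add: elog_0_divide limI)
  then have "cover_entropy {} \<phi> \<le> - \<infinity>"
    unfolding cover_entropy_def by (intro SUP_least) simp
  then show ?thesis by simp
qed

text \<open>Outer measure is monotone on all sets, so it does not matter that a large preimage under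
  \<open>\<phi>\<close> need not be Borel.\<close>

lemma invariant_measures_selection:
  assumes "\<And>x. x \<in> X \<Longrightarrow> f x \<in> \<phi> x"
  shows "invariant_measures X (\<lambda>x. {f x}) \<subseteq> invariant_measures X \<phi>"
proof
  fix M assume M: "M \<in> invariant_measures X (\<lambda>x. {f x})"
  have "outer_measure_of M (large_preimage X (\<lambda>x. {f x}) A) \<le> outer_measure_of M (large_preimage X \<phi> A)" for A
    using assms by (intro outer_measure_of_mono) (auto simp: large_preimage_def)
  then show "M \<in> invariant_measures X \<phi>"
    using M unfolding invariant_measures_def by (blast intro: order.trans)
qed

theorem proposition2:
  fixes X :: "'a::banach set" and \<phi> :: "'a \<Rightarrow> 'a set"
  assumes "compact X"
    and "multimap_on X X \<phi>"
    and "\<And>x. x \<in> X \<Longrightarrow> compact (\<phi> x)"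
    and "\<And>x. x \<in> X \<Longrightarrow> convex (\<phi> x)"
    and "lsc_on X X \<phi>"
    and "\<And>f \<mu>. continuous_selection X \<phi> f \<Longrightarrow> \<mu> \<in> invariant_measures X (\<lambda>x. {f x}) \<Longrightarrow>
           metric_entropy X \<phi> \<mu> \<ge> metric_entropy X (\<lambda>x. {f x}) \<mu>"
  shows "(SUP \<mu> \<in> invariant_measures X \<phi>. metric_entropy X \<phi> \<mu>) \<ge> h_sep_CMM X \<phi>
    \<and> h_sep_CMM X \<phi> \<ge> h_span_CMM X \<phi>
    \<and> (SUP \<mu> \<in> invariant_measures X \<phi>. metric_entropy X \<phi> \<mu>) \<ge> cover_entropy X \<phi>"
proof -
  have val: "\<phi> x \<noteq> {}" "\<phi> x \<subseteq> X" if "x \<in> X" for x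
    using assms(2) that by (auto simp: multimap_on_def)
  obtain f where f: "continuous_on X f" "\<And>x. x \<in> X \<Longrightarrow> f x \<in> \<phi> x"
  proof (rule michael_selection[OF assms(1), of \<phi>])
    \<comment> \<open>\<open>lsc_on X X\<close> tests relatively open subsets of \<open>X\<close>.
      Since the values lie in \<open>X\<close>, intersecting an open set with \<open>X\<close>
      leaves its large preimage unchanged.\<close>
    show "openin (top_of_set X) (large_preimage X \<phi> B)" if "open B" for B
    proof -
      have "large_preimage X \<phi> B = large_preimage X \<phi> (X \<inter> B)"
        using val by (auto simp: large_preimage_def)
      then show ?thesis using assms(5) that by (simp add: lsc_on_def openin_open_Int)
    qed
  qed (use val assms(3,4) in \<open>auto intro: compact_imp_closed\<close>)
  have fX: "f ` X \<subseteq> X" using f(2) val by blast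
  have span: "h_span_CMM X \<phi> \<le> h_sep_CMM X \<phi>"
    by (rule h_span_CMM_le_h_sep_CMM[OF fX f(2) assms(1)])
  show ?thesis
  \<comment> \<open>Nonempty separated sets, whose cardinalities have usable logarithms, exist only
    if \<open>X\<close> is nonempty.\<close>
  proof (cases "X = {}")
    case True
    then show ?thesis using span by (simp add: h_sep_CMM_empty cover_entropy_empty)
  next
    case False
    let ?S = "SUP M \<in> invariant_measures X (\<lambda>x. {f x}). metric_entropy X (\<lambda>x. {f x}) M"
    have sel: "continuous_selection X \<phi> f" using f fX by (simp add: continuous_selection_def)
    have le: "?S \<le> (SUP M \<in> invariant_measures X \<phi>. metric_entropy X \<phi> M)"
    proof (rule SUP_least)
      fix M assume M: "M \<in> invariant_measures X (\<lambda>x. {f x})"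
      have "metric_entropy X (\<lambda>x. {f x}) M \<le> metric_entropy X \<phi> M" by (rule assms(6)[OF sel M])
      also have "\<dots> \<le> (SUP M \<in> invariant_measures X \<phi>. metric_entropy X \<phi> M)"
        by (rule SUP_upper) (rule subsetD[OF invariant_measures_selection[OF f(2)] M])
      finally show "metric_entropy X (\<lambda>x. {f x}) M \<le> (SUP M \<in> invariant_measures X \<phi>. metric_entropy X \<phi> M)" .
    qed
    have "h_sep_CMM X \<phi> \<le> ?S" by (rule h_sep_CMM_le[OF assms(1) False f(1) fX f(2)])
    moreover have "cover_entropy X \<phi> \<le> ?S" by (rule cover_entropy_le[OF assms(1) False assms(2) f(1) fX f(2)])
    ultimately show ?thesis using span le by (intro conjI) (rule order.trans, assumption+)+
  qed
qed

end
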